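(* Let $(M,\omega)$ be a $2d$-dimensional symplectic manifold and let $f: M\to M$ be a diffeomorphism such that $f^*\omega=a\,\omega$ for some constant $a\in(0,1)$. Let $B(f)$ be the set of points $x\in M$ such that the sequence $(f^{-n}(x))_{n\in\mathbb N}$ does not tend to infinity as $n\to+\infty$. Then $\omega^{\wedge d}(B(f))=0$, i.e. $B(f)$ has zero measure for the volume form $\omega^{\wedge d}$.
   Context: A symplectic manifold is an even-dimensional manifold endowed with a closed non-degenerate 2-form. A sequence $(x_n)_{n\in\mathbb N}$ of points of a topological space $X$ tends to infinity if for every compact subset $K$ of $X$ there exists $N\in\mathbb N$ such that $x_n\notin K$ for all $n\ge N$. *)

theory Defs
  imports "HOL-Analysis.Analysis"
begin

section \<open>Smooth maps between open subsets of normed spaces\<close>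

text \<open>
  Only meaningful for open \<open>S\<close>. In finite dimension, continuity of all directional
  derivatives up to order \<open>k\<close> is the usual \<open>C\<close>-\<open>k\<close> condition.
\<close>

primrec Ck_on ::
  "nat \<Rightarrow> 'a::real_normed_vector set \<Rightarrow> ('a \<Rightarrow> 'b::real_normed_vector) \<Rightarrow> bool" where
  "Ck_on 0 S f \<longleftrightarrow> continuous_on S f"
| "Ck_on (Suc k) S f \<longleftrightarrow>
     (\<forall>x\<in>S. f differentiable (at x)) \<and> (\<forall>v. Ck_on k S (\<lambda>x. frechet_derivative f (at x) v))"

definition smooth_on ::
  "'a::real_normed_vector set \<Rightarrow> ('a \<Rightarrow> 'b::real_normed_vector) \<Rightarrow> bool" where
  "smooth_on S f \<longleftrightarrow> (\<forall>k. Ck_on k S f)"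


section \<open>Smooth manifolds\<close>

text \<open>
  A chart is a pair of its domain and its coordinate map; the values of the coordinate map
  outside the domain are irrelevant.
\<close>

type_synonym ('m, 'n) chart = "'m set \<times> ('m \<Rightarrow> real ^ 'n)"

definition chart_inv :: "('m, 'n) chart \<Rightarrow> real ^ 'n \<Rightarrow> 'm" where
  "chart_inv c = inv_into (fst c) (snd c)"

definition is_chart :: "'m topology \<Rightarrow> ('m, 'n::finite) chart \<Rightarrow> bool" where
  "is_chart X c \<longleftrightarrow>
     openin X (fst c) \<and> open (snd c ` fst c) \<and>
     homeomorphic_map (subtopology X (fst c)) (top_of_set (snd c ` fst c)) (snd c)"

text \<open>
  \<open>A\<close> is any smooth atlas, not necessarily maximal. Manifolds have no boundary and need not be
  connected or compact.
\<close>

locale smooth_manifold =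
  fixes X :: "'m topology" and A :: "('m, 'n::finite) chart set"
  assumes Hausdorff: "Hausdorff_space X"
    and second_countable: "second_countable X"
    and charts: "\<And>c. c \<in> A \<Longrightarrow> is_chart X c"
    and covering: "(\<Union>c\<in>A. fst c) = topspace X"
    and compatible: "\<And>c c'. c \<in> A \<Longrightarrow> c' \<in> A \<Longrightarrow>
          smooth_on (snd c ` (fst c \<inter> fst c')) (snd c' \<circ> chart_inv c)"

definition smooth_map ::
  "'m topology \<Rightarrow> ('m, 'n::finite) chart set \<Rightarrow> 'p topology \<Rightarrow> ('p, 'k::finite) chart set \<Rightarrow>
   ('m \<Rightarrow> 'p) \<Rightarrow> bool" where
  "smooth_map X A Y B f \<longleftrightarrow>
     continuous_map X Y f \<and>
     (\<forall>c\<in>A. \<forall>c'\<in>B. smooth_on (snd c ` {x \<in> fst c. f x \<in> fst c'}) (snd c' \<circ> f \<circ> chart_inv c))"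

definition diffeomorphism ::
  "'m topology \<Rightarrow> ('m, 'n::finite) chart set \<Rightarrow> 'p topology \<Rightarrow> ('p, 'k::finite) chart set \<Rightarrow>
   ('m \<Rightarrow> 'p) \<Rightarrow> bool" where
  "diffeomorphism X A Y B f \<longleftrightarrow>
     bij_betw f (topspace X) (topspace Y) \<and>
     smooth_map X A Y B f \<and> smooth_map Y B X A (inv_into (topspace X) f)"


section \<open>Tangent vectors\<close>

text \<open>
  A tangent vector at \<open>x\<close> is the family of its coordinate vectors in all charts of the atlas
  around \<open>x\<close>, related by the derivatives of the transition maps. The components at all other
  arguments are set to \<open>0\<close>, so that the tangent space is a vector space under pointwise
  operations.
\<close>

type_synonym ('m, 'n) tangent = "('m, 'n) chart \<Rightarrow> real ^ 'n"

definition transition_derivative ::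
  "('m, 'n::finite) chart \<Rightarrow> ('m, 'n) chart \<Rightarrow> 'm \<Rightarrow> real ^ 'n \<Rightarrow> real ^ 'n" where
  "transition_derivative c c' x = frechet_derivative (snd c' \<circ> chart_inv c) (at (snd c x))"

definition tangent_space :: "('m, 'n::finite) chart set \<Rightarrow> 'm \<Rightarrow> ('m, 'n) tangent set" where
  "tangent_space A x =
     {v. (\<forall>c. \<not> (c \<in> A \<and> x \<in> fst c) \<longrightarrow> v c = 0) \<and>
         (\<forall>c\<in>A. \<forall>c'\<in>A. x \<in> fst c \<longrightarrow> x \<in> fst c' \<longrightarrow> v c' = transition_derivative c c' x (v c))}"

text \<open>The tangent vector at \<open>x\<close> whose coordinates in the chart \<open>c\<close> are \<open>u\<close>.\<close>

definition coord_vector ::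
  "('m, 'n::finite) chart set \<Rightarrow> ('m, 'n) chart \<Rightarrow> 'm \<Rightarrow> real ^ 'n \<Rightarrow> ('m, 'n) tangent" where
  "coord_vector A c x u =
     (\<lambda>c'. if c' \<in> A \<and> x \<in> fst c' then transition_derivative c c' x u else 0)"

text \<open>By the chain rule the choice of the chart \<open>c\<close> around \<open>x\<close> is irrelevant.\<close>

definition differential ::
  "('m, 'n::finite) chart set \<Rightarrow> ('p, 'k::finite) chart set \<Rightarrow> ('m \<Rightarrow> 'p) \<Rightarrow> 'm \<Rightarrow>
   ('m, 'n) tangent \<Rightarrow> ('p, 'k) tangent" where
  "differential A B f x v =
     (let c = (SOME c. c \<in> A \<and> x \<in> fst c)
      in (\<lambda>c'. if c' \<in> B \<and> f x \<in> fst c'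
               then frechet_derivative (snd c' \<circ> f \<circ> chart_inv c) (at (snd c x)) (v c)
               else 0))"


section \<open>Differential forms\<close>

text \<open>
  A \<open>k\<close>-form takes a point and a list of \<open>k\<close> tangent vectors at this point; its values on other
  lists are irrelevant.
\<close>

type_synonym ('m, 'n) form = "'m \<Rightarrow> ('m, 'n) tangent list \<Rightarrow> real"

definition tangent_lists ::
  "('m, 'n::finite) chart set \<Rightarrow> nat \<Rightarrow> 'm \<Rightarrow> ('m, 'n) tangent list set" where
  "tangent_lists A k x = {vs. length vs = k \<and> set vs \<subseteq> tangent_space A x}"

definition alternating_multilinear ::
  "('m, 'n::finite) chart set \<Rightarrow> nat \<Rightarrow> 'm \<Rightarrow> (('m, 'n) tangent list \<Rightarrow> real) \<Rightarrow> bool" where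
  "alternating_multilinear A k x \<alpha> \<longleftrightarrow>
     (\<forall>vs\<in>tangent_lists A k x. \<forall>i<k. \<forall>u\<in>tangent_space A x. \<forall>w\<in>tangent_space A x. \<forall>a b.
        \<alpha> (vs[i := (\<lambda>c. a *\<^sub>R u c + b *\<^sub>R w c)]) = a * \<alpha> (vs[i := u]) + b * \<alpha> (vs[i := w])) \<and>
     (\<forall>vs\<in>tangent_lists A k x. \<forall>j<k. \<forall>i<j. vs ! i = vs ! j \<longrightarrow> \<alpha> vs = 0)"

text \<open>
  The function \<open>y \<mapsto> \<alpha>(u\<^sub>1, \<dots>, u\<^sub>k)\<close> in the chart \<open>c\<close>, for vector fields \<open>u\<^sub>1, \<dots>, u\<^sub>k\<close> with
  constant coordinates.
\<close>

definition local_form ::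
  "('m, 'n::finite) chart set \<Rightarrow> ('m, 'n) chart \<Rightarrow> ('m, 'n) form \<Rightarrow>
   (real ^ 'n) list \<Rightarrow> real ^ 'n \<Rightarrow> real" where
  "local_form A c \<alpha> us y = \<alpha> (chart_inv c y) (map (coord_vector A c (chart_inv c y)) us)"

definition differential_form ::
  "'m topology \<Rightarrow> ('m, 'n::finite) chart set \<Rightarrow> nat \<Rightarrow> ('m, 'n) form \<Rightarrow> bool" where
  "differential_form X A k \<alpha> \<longleftrightarrow>
     (\<forall>x\<in>topspace X. alternating_multilinear A k x (\<alpha> x)) \<and>
     (\<forall>c\<in>A. \<forall>us. length us = k \<longrightarrow> smooth_on (snd c ` fst c) (local_form A c \<alpha> us))"

text \<open>
  The exterior derivative of a \<open>k\<close>-form, computed in the chart \<open>c\<close>: the value at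
  \<open>(v\<^sub>0, \<dots>, v\<^sub>k)\<close> is the alternating sum of the derivatives in direction \<open>v\<^sub>i\<close> of the form
  evaluated on the remaining vectors, extended with constant coordinates.
\<close>

definition exterior_derivative ::
  "('m, 'n::finite) chart set \<Rightarrow> ('m, 'n) chart \<Rightarrow> nat \<Rightarrow> ('m, 'n) form \<Rightarrow> ('m, 'n) form" where
  "exterior_derivative A c k \<alpha> x vs =
     (let us = map (\<lambda>v. v c) vs
      in \<Sum>i\<le>k. (- 1) ^ i *
           frechet_derivative (local_form A c \<alpha> (take i us @ drop (Suc i) us))
             (at (snd c x)) (us ! i))"

definition closed_form ::
  "('m, 'n::finite) chart set \<Rightarrow> nat \<Rightarrow> ('m, 'n) form \<Rightarrow> bool" where
  "closed_form A k \<alpha> \<longleftrightarrow>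
     (\<forall>c\<in>A. \<forall>x\<in>fst c. \<forall>vs\<in>tangent_lists A (Suc k) x. exterior_derivative A c k \<alpha> x vs = 0)"

definition pullback ::
  "('m, 'n::finite) chart set \<Rightarrow> ('p, 'k::finite) chart set \<Rightarrow> ('m \<Rightarrow> 'p) \<Rightarrow>
   ('p, 'k) form \<Rightarrow> ('m, 'n) form" where
  "pullback A B f \<alpha> x vs = \<alpha> (f x) (map (differential A B f x) vs)"

text \<open>The exterior product of a \<open>k\<close>-form and an \<open>l\<close>-form.\<close>

definition wedge :: "nat \<Rightarrow> nat \<Rightarrow> ('m, 'n) form \<Rightarrow> ('m, 'n) form \<Rightarrow> ('m, 'n) form" where
  "wedge k l \<alpha> \<beta> x vs =
     (\<Sum>\<sigma> | \<sigma> permutes {..<k + l}.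
        of_int (sign \<sigma>) * \<alpha> x (take k (permute_list \<sigma> vs)) * \<beta> x (drop k (permute_list \<sigma> vs)))
     / (fact k * fact l)"

primrec wedge_power :: "nat \<Rightarrow> ('m, 'n) form \<Rightarrow> nat \<Rightarrow> ('m, 'n) form" where
  "wedge_power k \<alpha> 0 = (\<lambda>x vs. 1)"
| "wedge_power k \<alpha> (Suc j) = wedge k (k * j) \<alpha> (wedge_power k \<alpha> j)"


section \<open>Symplectic manifolds\<close>

definition nondegenerate ::
  "'m topology \<Rightarrow> ('m, 'n::finite) chart set \<Rightarrow> ('m, 'n) form \<Rightarrow> bool" where
  "nondegenerate X A \<omega> \<longleftrightarrow>
     (\<forall>x\<in>topspace X. \<forall>u\<in>tangent_space A x.
        (\<forall>w\<in>tangent_space A x. \<omega> x [u, w] = 0) \<longrightarrow> u = (\<lambda>c. 0))"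

locale symplectic_manifold = smooth_manifold X A
  for X :: "'m topology" and A :: "('m, 'n::finite) chart set" +
  fixes \<omega> :: "('m, 'n) form"
  assumes even_dimension: "even CARD('n)"
    and two_form: "differential_form X A 2 \<omega>"
    and closed: "closed_form A 2 \<omega>"
    and nondegenerate: "nondegenerate X A \<omega>"


section \<open>The measure of a form of top degree\<close>

text \<open>
  The Borel measure \<open>N\<close> on \<open>X\<close> that is given in every chart by the absolute value of the
  coefficient of \<open>\<mu>\<close>, i.e. of its value on the coordinate frame. It exists by change of variables
  and is unique because countably many chart domains cover \<open>X\<close>. The order on the index type
  \<open>'n\<close> is the order of the coordinates; it is a \<open>wellorder\<close> because the change of variables
  theorems of the library require this.
\<close>

definition coord_frame :: "(real ^ 'n::{finite,wellorder}) list" where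
  "coord_frame = map (\<lambda>i. axis i 1) (sorted_list_of_set UNIV)"

definition borel_sets_of :: "'m topology \<Rightarrow> 'm set set" where
  "borel_sets_of X = sigma_sets (topspace X) {U. openin X U}"

definition form_measure ::
  "'m topology \<Rightarrow> ('m, 'n::{finite,wellorder}) chart set \<Rightarrow> ('m, 'n) form \<Rightarrow> 'm measure" where
  "form_measure X A \<mu> =
     (THE N. space N = topspace X \<and> sets N = borel_sets_of X \<and>
        (\<forall>c\<in>A. \<forall>E\<in>borel_sets_of X. E \<subseteq> fst c \<longrightarrow>
           emeasure N E =
             (\<integral>\<^sup>+y\<in>snd c ` E. ennreal \<bar>local_form A c \<mu> coord_frame y\<bar> \<partial>lborel)))"


section \<open>Points whose backward orbit does not tend to infinity\<close>

definition tends_to_infinity :: "'m topology \<Rightarrow> (nat \<Rightarrow> 'm) \<Rightarrow> bool" where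
  "tends_to_infinity X s \<longleftrightarrow> (\<forall>K. compactin X K \<longrightarrow> (\<exists>N. \<forall>n\<ge>N. s n \<notin> K))"

definition backward_nonescaping :: "'m topology \<Rightarrow> ('m \<Rightarrow> 'm) \<Rightarrow> 'm set" where
  "backward_nonescaping X f =
     {x \<in> topspace X. \<not> tends_to_infinity X (\<lambda>n. (inv_into (topspace X) f ^^ n) x)}"

end

theory Submission
  imports Defs
begin

text \<open>
  The idea is that \<open>f\<close> contracts volume. From \<open>f\<^sup>* \<omega> = a \<omega>\<close> one gets
  \<open>f\<^sup>* (\<omega>\<^sup>d) = a\<^sup>d \<omega>\<^sup>d\<close>, so the volume measure \<open>\<mu>\<close> satisfies
  \<open>\<mu> (f E) = a\<^sup>d \<mu> E\<close>, with \<open>a\<^sup>d < 1\<close> because the dimension \<open>2 d\<close> is positive. If the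
  backward orbit of \<open>x\<close> does not tend to infinity, it visits some compact set infinitely often.
  Countably many compact sets \<open>L\<close> of finite measure have interiors that cover the manifold, so
  one of them is visited infinitely often; this means that \<open>x\<close> lies in infinitely many of the
  sets \<open>f\<^sup>n L\<close>. Their measures \<open>(a\<^sup>d)\<^sup>n \<mu> L\<close> form a convergent geometric series, and by
  Borel and Cantelli the set of such \<open>x\<close> is null for each \<open>L\<close>.

  The work lies in the volume measure. Its definition is a definite description, so it has a
  meaning only once a measure with the prescribed chart densities is known to exist
  (\<open>chart_compatible_exists\<close>) and to be unique (\<open>chart_compatible_unique\<close>). Both the
  consistency of the densities in overlapping charts and the contraction by \<open>f\<close> are instances of
  one transformation law (\<open>wedge_power_density\<close>): if a smooth map \<open>h\<close> pulls \<open>\<omega>\<close> back to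
  \<open>k \<omega>\<close>, the Jacobian of \<open>h\<close> in charts changes the coefficient of \<open>\<omega>\<^sup>d\<close> by the factor
  \<open>k\<^sup>d\<close>. For overlaps one takes \<open>h = id\<close> and \<open>k = 1\<close>. The law rests on the fact that an
  alternating form in as many vectors as the dimension is a multiple of the determinant
  (\<open>alternating_eq_det\<close>); it becomes a statement about measures through the change of variables
  formula for nonnegative functions (\<open>nn_integral_change_of_variables\<close>).
\<close>

section \<open>Antisymmetrized multilinear forms and the determinant\<close>

text \<open>
  Forms are evaluated on lists of vectors, so that the number of arguments may vary with the
  degree inside one statement.
\<close>

definition multilinear :: "nat \<Rightarrow> ('a::real_vector list \<Rightarrow> real) \<Rightarrow> bool" where
  "multilinear k T \<longleftrightarrow> (\<forall>us i. length us = k \<longrightarrow> i < k \<longrightarrow> linear (\<lambda>v. T (us[i := v])))"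

lemma linear_cmult: "linear f \<Longrightarrow> linear (\<lambda>v. c * f v :: real)"
  and linear_multc: "linear f \<Longrightarrow> linear (\<lambda>v. f v * c :: real)"
  by (auto simp: linear_iff algebra_simps)

lemma multilinear_tensor:
  assumes \<alpha>: "multilinear k \<alpha>" and \<beta>: "multilinear l \<beta>"
  shows "multilinear (k + l) (\<lambda>us. \<alpha> (take k us) * \<beta> (drop k us))"
  unfolding multilinear_def
proof (intro allI impI)
  fix us :: "'a list" and i assume us: "length us = k + l" and i: "i < k + l"
  show "linear (\<lambda>v. \<alpha> (take k (us[i := v])) * \<beta> (drop k (us[i := v])))"
  proof (cases "i < k")
    case True
    have "linear (\<lambda>v. \<alpha> ((take k us)[i := v]))"
      using \<alpha> us True by (simp add: multilinear_def)
    then show ?thesis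
      using True by (simp add: take_update_swap linear_multc)
  next
    case False
    have "linear (\<lambda>v. \<beta> ((drop k us)[i - k := v]))"
      using \<beta> us False i by (simp add: multilinear_def)
    then show ?thesis
      using False by (simp add: drop_update_swap linear_cmult)
  qed
qed

lemma permute_list_update:
  assumes \<sigma>: "\<sigma> permutes {..<length us}" and i: "i < length us"
  shows "permute_list \<sigma> (us[i := v]) = (permute_list \<sigma> us)[inv \<sigma> i := v]"
proof (rule nth_equalityI)
  fix j assume "j < length (permute_list \<sigma> (us[i := v]))"
  then have j: "j < length us" by simp
  have "\<sigma> j < length us" using permutes_in_image[OF \<sigma>] j by auto
  moreover have "inv \<sigma> i = j \<longleftrightarrow> \<sigma> j = i"
    using permutes_inverses[OF \<sigma>] by metis
  ultimately show "permute_list \<sigma> (us[i := v]) ! j = (permute_list \<sigma> us)[inv \<sigma> i := v] ! j"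
    using \<sigma> j i by (auto simp: permute_list_nth nth_list_update)
qed simp

text \<open>
  The wedge product is the antisymmetrization of the tensor product, up to a constant factor.
\<close>

definition antisymmetrization :: "nat \<Rightarrow> ('a list \<Rightarrow> real) \<Rightarrow> 'a list \<Rightarrow> real" where
  "antisymmetrization k T us = (\<Sum>\<sigma> | \<sigma> permutes {..<k}. of_int (sign \<sigma>) * T (permute_list \<sigma> us))"

lemma multilinear_antisymmetrization:
  assumes T: "multilinear k T"
  shows "multilinear k (antisymmetrization k T)"
  unfolding multilinear_def antisymmetrization_def
proof (intro allI impI linear_compose_sum ballI linear_cmult)
  fix us :: "'a list" and i \<sigma> assume us: "length us = k" "i < k" and "\<sigma> \<in> {\<sigma>. \<sigma> permutes {..<k}}"
  then have \<sigma>: "\<sigma> permutes {..<length us}" by simp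
  have "inv \<sigma> i < length us"
    using permutes_in_image[OF permutes_inv[OF \<sigma>]] us by auto
  then show "linear (\<lambda>v. T (permute_list \<sigma> (us[i := v])))"
    using T us by (simp add: permute_list_update[OF \<sigma>] multilinear_def)
qed

text \<open>
  Composing with the transposition of the two equal entries is an involution of the permutations
  that keeps the value of \<open>T\<close> and reverses the sign, so the sum equals its own negative.
\<close>

lemma antisymmetrization_alternating:
  assumes us: "length us = k" and ij: "i < k" "j < k" "i \<noteq> j" and eq: "us ! i = us ! j"
  shows "antisymmetrization k T us = 0"
proof -
  let ?t = "Transposition.transpose i j"
  have t: "?t permutes {..<k}" using ij by (simp add: permutes_swap_id)
  have fixed: "permute_list ?t us = us"
    using us ij eq t by (intro nth_equalityI) (auto simp: permute_list_nth Transposition.transpose_def)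
  have "antisymmetrization k T us
      = (\<Sum>\<sigma> | \<sigma> permutes {..<k}. of_int (sign (?t \<circ> \<sigma>)) * T (permute_list (?t \<circ> \<sigma>) us))"
    unfolding antisymmetrization_def by (rule sum.reindex_bij_witness[of _ "\<lambda>\<sigma>. ?t \<circ> \<sigma>" "\<lambda>\<sigma>. ?t \<circ> \<sigma>"])
      (auto simp: permutes_compose[OF _ t] comp_assoc[symmetric])
  also have "\<dots> = (\<Sum>\<sigma> | \<sigma> permutes {..<k}. - (of_int (sign \<sigma>) * T (permute_list \<sigma> us)))"
  proof (rule sum.cong[OF refl])
    fix \<sigma> assume "\<sigma> \<in> {\<sigma>. \<sigma> permutes {..<k}}"
    then have \<sigma>: "\<sigma> permutes {..<k}" by simp
    then have "permute_list (?t \<circ> \<sigma>) us = permute_list \<sigma> us"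
      using us fixed by (simp add: permute_list_compose)
    moreover have "sign (?t \<circ> \<sigma>) = - sign \<sigma>"
      using \<sigma> t ij by (simp add: sign_compose sign_swap_id permutes_imp_permutation[of "{..<k}"])
    ultimately show "of_int (sign (?t \<circ> \<sigma>)) * T (permute_list (?t \<circ> \<sigma>) us)
        = - (of_int (sign \<sigma>) * T (permute_list \<sigma> us))" by simp
  qed
  finally show ?thesis
    by (simp add: sum_negf antisymmetrization_def)
qed

text \<open>
  Polarization: a form that vanishes when two arguments agree changes sign when they are swapped,
  as one sees by expanding its value at \<open>(u + v, u + v)\<close>.
\<close>

lemma alternating_swap:
  fixes F :: "('n \<Rightarrow> 'a::real_vector) \<Rightarrow> real"
  assumes lin: "\<And>r i. linear (\<lambda>v. F (r(i := v)))"
    and alt: "\<And>r i j. i \<noteq> j \<Longrightarrow> r i = r j \<Longrightarrow> F r = 0"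
    and ne: "m \<noteq> n"
  shows "F (r \<circ> Transposition.transpose m n) = - F r"
proof -
  let ?x = "r m" and ?y = "r n"
  let ?R = "\<lambda>u v. r(m := u, n := v)"
  have add2: "F (?R u (v + w)) = F (?R u v) + F (?R u w)" for u v w
    using lin[of "r(m := u)" n] by (simp add: linear_iff)
  have comm: "?R u v = (r(n := v))(m := u)" for u v
    using ne by (simp add: fun_upd_twist)
  have add1: "F (?R (u + w) v) = F (?R u v) + F (?R w v)" for u v w
    using lin[of "r(n := v)" m] by (simp only: comm) (simp add: linear_iff)
  have "F (?R u u) = 0" for u
    by (rule alt[OF ne]) (use ne in simp)
  from this[of "?x + ?y"] this[of ?x] this[of ?y]
  have "F (?R ?x ?y) + F (?R ?y ?x) = 0"
    by (simp add: add1 add2)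
  moreover have "?R ?x ?y = r" by simp
  moreover have "?R ?y ?x = r \<circ> Transposition.transpose m n"
    using ne by (auto simp: fun_eq_iff Transposition.transpose_def)
  ultimately show ?thesis by simp
qed

text \<open>
  The determinant is, up to a factor, the only alternating multilinear function of the rows.
  Row operations reduce a matrix to diagonal form. The induction quantifies over all \<open>F\<close>,
  since swapping two columns of the matrix amounts to composing \<open>F\<close> with the linear map that
  swaps the two coordinates.
\<close>

lemma alternating_eq_det:
  fixes F :: "('n::finite \<Rightarrow> real ^ 'n) \<Rightarrow> real"
  assumes "\<And>r i. linear (\<lambda>v. F (r(i := v)))"
    and "\<And>r i j. i \<noteq> j \<Longrightarrow> r i = r j \<Longrightarrow> F r = 0"
  shows "F (\<lambda>i. row i M) = det M * F (\<lambda>i. axis i 1)"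
proof -
  define P where "P M \<longleftrightarrow> (\<forall>F :: ('n \<Rightarrow> real ^ 'n) \<Rightarrow> real.
      (\<forall>r i. linear (\<lambda>v. F (r(i := v)))) \<longrightarrow> (\<forall>r i j. i \<noteq> j \<longrightarrow> r i = r j \<longrightarrow> F r = 0) \<longrightarrow>
      F (\<lambda>i. row i M) = det M * F (\<lambda>i. axis i 1))" for M :: "real ^ 'n ^ 'n"
  have "P M"
  proof (induct M rule: induct_matrix_row_operations)
    case (1 M i)
    show ?case unfolding P_def
    proof (intro allI impI)
      fix F :: "('n \<Rightarrow> real ^ 'n) \<Rightarrow> real" assume lin: "\<forall>r i. linear (\<lambda>v. F (r(i := v)))"
      have "F ((\<lambda>i. row i M)(i := 0)) = 0"
        using lin linear_0 by blast
      moreover have "(\<lambda>i. row i M)(i := 0) = (\<lambda>i. row i M)"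
        using 1 by auto
      moreover have "det M = 0" using 1 by (rule det_zero_row(2))
      ultimately show "F (\<lambda>i. row i M) = det M * F (\<lambda>i. axis i 1)" by simp
    qed
  next
    case (2 M)
    show ?case unfolding P_def
    proof (intro allI impI)
      fix F :: "('n \<Rightarrow> real ^ 'n) \<Rightarrow> real" assume lin: "\<forall>r i. linear (\<lambda>v. F (r(i := v)))"
      have *: "F (\<lambda>i. if i \<in> J then M $ i $ i *\<^sub>R axis i 1 else axis i 1)
          = (\<Prod>i\<in>J. M $ i $ i) * F (\<lambda>i. axis i 1)" if "finite J" for J
        using that
      proof induction
        case (insert k J)
        let ?r = "\<lambda>J i. if i \<in> J then M $ i $ i *\<^sub>R axis i 1 else (axis i 1 :: real ^ 'n)"
        have "?r (insert k J) = (?r J)(k := M $ k $ k *\<^sub>R axis k 1)" by auto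
        then have "F (?r (insert k J)) = M $ k $ k *\<^sub>R F ((?r J)(k := axis k 1))"
          using linear_scale[OF lin[rule_format, of "?r J" k], of "M $ k $ k" "axis k 1"] by simp
        also have "(?r J)(k := axis k 1) = ?r J" using insert(2) by auto
        finally show ?case using insert by simp
      qed simp
      have "row i M = M $ i $ i *\<^sub>R axis i 1" for i
        using 2 by (auto simp: vec_eq_iff row_def axis_def)
      with *[of UNIV] show "F (\<lambda>i. row i M) = det M * F (\<lambda>i. axis i 1)"
        using det_diagonal[of M] 2 by simp
    qed
  next
    case (3 M m n)
    show ?case unfolding P_def
    proof (intro allI impI)
      fix F :: "('n \<Rightarrow> real ^ 'n) \<Rightarrow> real"
      assume lin: "\<forall>r i. linear (\<lambda>v. F (r(i := v)))"
        and alt: "\<forall>r i j. i \<noteq> j \<longrightarrow> r i = r j \<longrightarrow> F r = 0"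
      let ?t = "Transposition.transpose m n"
      define L :: "real ^ 'n \<Rightarrow> real ^ 'n" where "L v = (\<chi> j. v $ ?t j)" for v
      have L: "linear L" by (auto simp: L_def linear_iff vec_eq_iff)
      define G where "G r = F (L \<circ> r)" for r
      have "linear (\<lambda>v. G (r(i := v)))" for r i
      proof -
        have "(\<lambda>v. G (r(i := v))) = (\<lambda>v. F ((L \<circ> r)(i := v))) \<circ> L"
          by (auto simp: G_def fun_eq_iff fun_upd_comp)
        then show ?thesis
          using linear_compose[OF L lin[rule_format, of "L \<circ> r" i]] by simp
      qed
      moreover have "G r = 0" if "i \<noteq> j" "r i = r j" for r i j
        using alt that by (simp add: G_def)
      ultimately have "G (\<lambda>i. row i M) = det M * G (\<lambda>i. axis i 1)"
        using 3(1) unfolding P_def by blast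
      moreover have "L \<circ> (\<lambda>i. row i M) = (\<lambda>i. row i (\<chi> i j. M $ i $ ?t j))"
        by (simp add: L_def fun_eq_iff vec_eq_iff row_def)
      moreover have "L \<circ> (\<lambda>i. axis i 1) = (\<lambda>i. axis i 1) \<circ> ?t"
        by (auto simp: L_def fun_eq_iff vec_eq_iff axis_def Transposition.transpose_def)
      moreover have "F ((\<lambda>i. axis i 1) \<circ> ?t) = - F (\<lambda>i. axis i 1)"
        by (rule alternating_swap[OF lin[rule_format] alt[rule_format] 3(2)])
      moreover have "det (\<chi> i j. M $ i $ ?t j) = - det M"
        using det_permute_columns[of ?t M] 3(2) by (simp add: permutes_swap_id sign_swap_id)
      ultimately show "F (\<lambda>i. row i (\<chi> i j. M $ i $ ?t j))
          = det (\<chi> i j. M $ i $ ?t j) * F (\<lambda>i. axis i 1)"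
        by (simp add: G_def)
    qed
  next
    case (4 M m n c)
    show ?case unfolding P_def
    proof (intro allI impI)
      fix F :: "('n \<Rightarrow> real ^ 'n) \<Rightarrow> real"
      assume lin: "\<forall>r i. linear (\<lambda>v. F (r(i := v)))"
        and alt: "\<forall>r i j. i \<noteq> j \<longrightarrow> r i = r j \<longrightarrow> F r = 0"
      let ?N = "\<chi> i. if i = m then row m M + c *\<^sub>R row n M else row i M"
      let ?r = "\<lambda>i. row i M"
      have "(\<lambda>i. row i ?N) = ?r(m := row m M + c *\<^sub>R row n M)"
        by (auto simp: fun_eq_iff row_def vec_eq_iff)
      then have "F (\<lambda>i. row i ?N) = F (?r(m := row m M)) + c *\<^sub>R F (?r(m := row n M))"
        using lin by (simp add: linear_iff)
      also have "F (?r(m := row n M)) = 0"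
        using alt 4(2) by (metis (no_types, lifting) fun_upd_apply)
      also have "?r(m := row m M) = ?r" by (simp add: fun_eq_iff)
      also have "F ?r = det M * F (\<lambda>i. axis i 1)"
        using 4(1) lin alt unfolding P_def by blast
      also have "det M = det ?N"
        using det_row_operation[OF 4(2), of M c] unfolding scalar_mult_eq_scaleR by (rule sym)
      finally show "F (\<lambda>i. row i ?N) = det ?N * F (\<lambda>i. axis i 1)" by simp
    qed
  qed
  then show ?thesis using assms unfolding P_def by blast
qed

text \<open>
  The antisymmetrization is multilinear and alternating in the vectors attached to the entries
  of \<open>xs\<close>, so the uniqueness of the determinant applies to it. The images of the basis vectors
  are the columns of the matrix of \<open>L\<close>, i.e. the rows of its transpose.
\<close>

lemma antisymmetrization_linear_image:
  fixes L :: "real ^ 'n::finite \<Rightarrow> real ^ 'n"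
  assumes T: "multilinear (CARD('n)) T" and L: "linear L"
    and xs: "distinct xs" "set xs = (UNIV :: 'n set)"
  shows "antisymmetrization (CARD('n)) T (map (\<lambda>i. L (axis i 1)) xs)
    = det (matrix L) * antisymmetrization (CARD('n)) T (map (\<lambda>i. axis i 1) xs)"
proof -
  let ?S = "antisymmetrization (CARD('n)) T"
  define F where "F r = ?S (map r xs)" for r
  have len: "length xs = CARD('n)" using xs by (metis distinct_card)
  have idx: "\<exists>k<CARD('n). xs ! k = i" for i
    using xs len by (metis UNIV_I in_set_conv_nth)
  have lin: "linear (\<lambda>v. F (r(i := v)))" for r i
  proof -
    obtain k where k: "k < CARD('n)" "xs ! k = i" using idx by blast
    have "map (r(i := v)) xs = (map r xs)[k := v]" for v
      using k xs(1) len by (auto intro!: nth_equalityI simp: nth_list_update nth_eq_iff_index_eq)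
    then show ?thesis
      using multilinear_antisymmetrization[OF T] k len by (simp add: F_def multilinear_def)
  qed
  have alt: "F r = 0" if "i \<noteq> j" "r i = r j" for r i j
  proof -
    obtain k l where "k < CARD('n)" "xs ! k = i" "l < CARD('n)" "xs ! l = j" using idx by metis
    then show ?thesis
      using that len unfolding F_def by (intro antisymmetrization_alternating[of _ _ k l]) auto
  qed
  have "(\<lambda>i. row i (transpose (matrix L))) = (\<lambda>i. L (axis i 1))"
    by (simp add: fun_eq_iff row_transpose column_def matrix_def vec_eq_iff)
  then have "F (\<lambda>i. L (axis i 1)) = det (transpose (matrix L)) * F (\<lambda>i. axis i 1)"
    using alternating_eq_det[of F "transpose (matrix L)"] lin alt by simp
  then show ?thesis by (simp add: F_def det_transpose)
qed

section \<open>Change of variables for nonnegative functions\<close>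

text \<open>
  The change of variables theorem for absolutely integrable vector-valued functions, read as an
  identity of nonnegative integrals. The real function \<open>h\<close> is regarded as a function into the
  one-dimensional space.
\<close>

lemma nn_integral_image_bounded:
  fixes \<phi> :: "real ^ 'n::{finite,wellorder} \<Rightarrow> real ^ 'n::_" and h :: "real ^ 'n::_ \<Rightarrow> real"
  assumes S: "S \<in> sets lebesgue"
    and der: "\<And>y. y \<in> S \<Longrightarrow> (\<phi> has_derivative \<phi>' y) (at y within S)"
    and inj: "inj_on \<phi> S"
    and nonneg: "\<And>x. 0 \<le> h x"
    and int: "(\<lambda>y. \<bar>det (matrix (\<phi>' y))\<bar> * h (\<phi> y)) absolutely_integrable_on S"
  shows "h absolutely_integrable_on \<phi> ` S"
    and "(\<integral>\<^sup>+x\<in>\<phi> ` S. ennreal (h x) \<partial>lborel)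
       = (\<integral>\<^sup>+y\<in>S. ennreal (\<bar>det (matrix (\<phi>' y))\<bar> * h (\<phi> y)) \<partial>lborel)"
proof -
  let ?G = "\<lambda>y. \<bar>det (matrix (\<phi>' y))\<bar> * h (\<phi> y)"
  let ?v = "vec :: real \<Rightarrow> real ^ 1"
  have eq: "(\<lambda>y. \<bar>det (matrix (\<phi>' y))\<bar> *\<^sub>R ?v (h (\<phi> y))) = (\<lambda>y. ?v (?G y))"
    by (simp add: fun_eq_iff vec_eq_iff)
  have "(\<lambda>y. ?v (?G y)) absolutely_integrable_on S"
    using int by (simp add: absolutely_integrable_on_1_iff)
  then have *: "(\<lambda>x. ?v (h x)) absolutely_integrable_on \<phi> ` S \<and>
      integral (\<phi> ` S) (\<lambda>x. ?v (h x)) = integral S (\<lambda>y. ?v (?G y))"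
    using has_absolute_integral_change_of_variables [OF S der inj, of "\<lambda>x. ?v (h x)"] eq by auto
  then show hint: "h absolutely_integrable_on \<phi> ` S"
    by (simp add: absolutely_integrable_on_1_iff)
  have "integral (\<phi> ` S) h = integral S ?G"
    using * by (simp add: integral_on_1_eq vec_eq_iff)
  moreover have "(h has_integral integral (\<phi> ` S) h) (\<phi> ` S)" "(?G has_integral integral S ?G) S"
    using hint int by (auto simp: absolutely_integrable_on_def integrable_integral)
  ultimately have "integral\<^sup>N lborel (\<lambda>x. ennreal (indicator (\<phi> ` S) x * h x)) =
     integral\<^sup>N lborel (\<lambda>x. ennreal (indicator S x * ?G x))"
    using nn_integral_has_integral_lebesgue[of "\<phi> ` S" h] nn_integral_has_integral_lebesgue[of S ?G] nonneg
    by simp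
  moreover have "ennreal (indicator B x * t) = ennreal t * indicator B x" for B and x :: "real^'n::_" and t
    by (simp add: indicator_def)
  ultimately show "(\<integral>\<^sup>+x\<in>\<phi> ` S. ennreal (h x) \<partial>lborel) = (\<integral>\<^sup>+y\<in>S. ennreal (?G y) \<partial>lborel)"
    by simp
qed

text \<open>
  Monotone convergence; absolute integrability on \<open>S m\<close> contains the Lebesgue measurability of
  the truncation of \<open>f\<close> to this set.
\<close>

lemma nn_integral_increasing_sets:
  fixes f :: "'a::euclidean_space \<Rightarrow> real"
  assumes "\<And>x. 0 \<le> f x" and "incseq S"
    and "\<And>m. f absolutely_integrable_on S m"
  shows "(\<integral>\<^sup>+x\<in>(\<Union>m. S m). ennreal (f x) \<partial>lborel) = (SUP m. \<integral>\<^sup>+x\<in>S m. ennreal (f x) \<partial>lborel)"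
proof -
  have m: "(\<lambda>x. ennreal (f x) * indicator (S m) x) \<in> borel_measurable lebesgue" for m
  proof -
    have "(\<lambda>x. indicator (S m) x *\<^sub>R f x) \<in> borel_measurable lebesgue"
      using assms(3)[of m] by (simp add: set_integrable_def borel_measurable_integrable)
    then have "(\<lambda>x. ennreal (indicator (S m) x *\<^sub>R f x)) \<in> borel_measurable lebesgue"
      by measurable
    moreover have "(\<lambda>x. ennreal (indicator (S m) x *\<^sub>R f x)) = (\<lambda>x. ennreal (f x) * indicator (S m) x)"
      by (auto simp: fun_eq_iff indicator_def)
    ultimately show ?thesis by simp
  qed
  have "ennreal (f x) * indicator (\<Union>m. S m) x = (SUP m. ennreal (f x) * indicator (S m) x)" for x
  proof (cases "x \<in> (\<Union>m. S m)")
    case True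
    then obtain k where k: "x \<in> S k" by auto
    show ?thesis
    proof (rule antisym)
      show "ennreal (f x) * indicator (\<Union>m. S m) x \<le> (SUP m. ennreal (f x) * indicator (S m) x)"
        using k by (intro SUP_upper2[of k]) (auto simp: indicator_def)
      show "(SUP m. ennreal (f x) * indicator (S m) x) \<le> ennreal (f x) * indicator (\<Union>m. S m) x"
        by (intro SUP_least) (auto simp: indicator_def)
    qed
  next
    case False
    then show ?thesis by (simp add: indicator_def)
  qed
  then have "(\<integral>\<^sup>+x\<in>(\<Union>m. S m). ennreal (f x) \<partial>lborel)
      = (\<integral>\<^sup>+x. (SUP m. ennreal (f x) * indicator (S m) x) \<partial>lebesgue)"
    by (simp add: nn_integral_completion)
  also have "\<dots> = (SUP m. \<integral>\<^sup>+x. ennreal (f x) * indicator (S m) x \<partial>lebesgue)"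
    using assms(2) m
    by (intro nn_integral_monotone_convergence_SUP)
       (auto simp: incseq_def le_fun_def indicator_def)
  finally show ?thesis by (simp add: nn_integral_completion)
qed

text \<open>
  Both sides may be infinite here. The set \<open>S\<close> is exhausted by the bounded parts on which the
  transformed integrand is bounded, and there the integrable version applies.
\<close>

lemma nn_integral_change_of_variables:
  fixes \<phi> :: "real ^ 'n::{finite,wellorder} \<Rightarrow> real ^ 'n::_" and h :: "real ^ 'n::_ \<Rightarrow> real"
  assumes S: "S \<in> sets borel"
    and der: "\<And>y. y \<in> S \<Longrightarrow> (\<phi> has_derivative \<phi>' y) (at y)"
    and inj: "inj_on \<phi> S"
    and nonneg: "\<And>x. 0 \<le> h x"
    and G: "G \<in> borel_measurable borel"
    and G_eq: "\<And>y. y \<in> S \<Longrightarrow> \<bar>det (matrix (\<phi>' y))\<bar> * h (\<phi> y) = G y"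
  shows "(\<integral>\<^sup>+x\<in>\<phi> ` S. ennreal (h x) \<partial>lborel) = (\<integral>\<^sup>+y\<in>S. ennreal (G y) \<partial>lborel)"
proof -
  let ?G = "\<lambda>y. \<bar>det (matrix (\<phi>' y))\<bar> * h (\<phi> y)"
  define T where "T m = S \<inter> cball 0 (real m) \<inter> {y. G y \<le> real m}" for m :: nat
  have T: "T m \<in> sets borel" for m
    unfolding T_def using S G by measurable
  have Tl: "T m \<in> sets lebesgue" for m
    using T[of m] by simp
  have TS: "T m \<subseteq> S" for m
    by (auto simp: T_def)
  have inc: "incseq T"
    unfolding incseq_def T_def by (auto intro: order_trans[of _ "real _"])
  have U: "(\<Union>m. T m) = S"
  proof -
    have "\<exists>m. y \<in> T m" if "y \<in> S" for y
    proof -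
      obtain m :: nat where "max (norm y) (G y) \<le> real m"
        using real_arch_simple by blast
      then show ?thesis using that by (auto simp: T_def)
    qed
    then show ?thesis using TS by blast
  qed
  have int: "?G absolutely_integrable_on T m" for m
  proof -
    have "T m \<in> lmeasurable"
      using T[of m] by (intro bounded_set_imp_lmeasurable[OF bounded_subset[of "cball 0 (real m)"]])
        (auto simp: T_def)
    then have "set_integrable lebesgue (T m) (\<lambda>y. real m)"
      by (auto simp: set_integrable_def fmeasurable_def intro!: integrable_real_indicator)
    moreover have "set_borel_measurable lebesgue (T m) G"
      unfolding set_borel_measurable_def
      using G T[of m] by (intro borel_measurable_scaleR measurable_completion) auto
    ultimately have "G absolutely_integrable_on T m"
    proof (rule set_integrable_bound)
      show "AE x in lebesgue. x \<in> T m \<longrightarrow> norm (G x) \<le> norm (real m)"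
      proof (intro AE_I2 impI)
        fix x assume x: "x \<in> T m"
        have "0 \<le> G x"
          using G_eq[of x] nonneg[of "\<phi> x"] x TS
          by (metis abs_ge_zero mult_nonneg_nonneg subsetD)
        with x show "norm (G x) \<le> norm (real m)" by (simp add: T_def)
      qed
    qed
    moreover have "G x = ?G x" if "x \<in> T m" for x
      using G_eq[of x] TS[of m] that by (metis subsetD)
    ultimately show ?thesis
      unfolding set_integrable_def
      by (subst Bochner_Integration.integrable_cong[OF refl, where g = "\<lambda>x. indicator (T m) x *\<^sub>R G x"])
         (auto simp: indicator_def)
  qed
  have derT: "(\<phi> has_derivative \<phi>' y) (at y within T m)" if "y \<in> T m" for y m
    using der that TS by (meson has_derivative_at_withinI subsetD)
  have injT: "inj_on \<phi> (T m)" for m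
    using inj TS by (rule inj_on_subset)
  note B = nn_integral_image_bounded[OF Tl derT injT nonneg int]
  have "(\<integral>\<^sup>+x\<in>\<phi> ` S. ennreal (h x) \<partial>lborel) = (\<integral>\<^sup>+x\<in>(\<Union>m. \<phi> ` T m). ennreal (h x) \<partial>lborel)"
    using U by (simp add: image_UN[symmetric])
  also have "\<dots> = (SUP m. \<integral>\<^sup>+x\<in>\<phi> ` T m. ennreal (h x) \<partial>lborel)"
    using inc by (intro nn_integral_increasing_sets nonneg B(1)) (auto simp: incseq_def intro!: image_mono)
  also have "\<dots> = (SUP m. \<integral>\<^sup>+y\<in>T m. ennreal (?G y) \<partial>lborel)"
    by (simp only: B(2))
  also have "\<dots> = (\<integral>\<^sup>+y\<in>(\<Union>m. T m). ennreal (?G y) \<partial>lborel)"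
    using inc int nonneg by (intro nn_integral_increasing_sets[symmetric]) auto
  also have "\<dots> = (\<integral>\<^sup>+y\<in>S. ennreal (G y) \<partial>lborel)"
    unfolding U using G_eq by (intro nn_integral_cong) (auto simp: indicator_def)
  finally show ?thesis .
qed

section \<open>Derivatives in charts\<close>

lemma smooth_on_differentiable: "smooth_on S f \<Longrightarrow> y \<in> S \<Longrightarrow> f differentiable (at y)"
  unfolding smooth_on_def using Ck_on.simps(2)[of 0 S f] by blast

text \<open>
  The derivative of \<open>h\<close> in the charts \<open>c\<close> and \<open>c'\<close>. Coordinate changes are the case
  \<open>h = id\<close>, so that one chain rule covers the transition maps and the given diffeomorphism.
\<close>

definition local_derivative ::
  "('m, 'n::finite) chart \<Rightarrow> ('m, 'n) chart \<Rightarrow> ('m \<Rightarrow> 'm) \<Rightarrow> 'm \<Rightarrow> real ^ 'n \<Rightarrow> real ^ 'n" where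
  "local_derivative c c' h x = frechet_derivative (snd c' \<circ> h \<circ> chart_inv c) (at (snd c x))"

lemma transition_derivative_eq: "transition_derivative c c' x = local_derivative c c' id x"
  by (simp add: transition_derivative_def local_derivative_def)

context smooth_manifold
begin

lemma chart_domain:
  assumes "c \<in> A"
  shows "openin X (fst c)" "fst c \<subseteq> topspace X" "open (snd c ` fst c)" "inj_on (snd c) (fst c)"
proof -
  from charts[OF assms] have *: "openin X (fst c)" "open (snd c ` fst c)"
    "homeomorphic_map (subtopology X (fst c)) (top_of_set (snd c ` fst c)) (snd c)"
    by (auto simp: is_chart_def)
  show "openin X (fst c)" "open (snd c ` fst c)" by (fact *)+
  show "fst c \<subseteq> topspace X" using *(1) by (rule openin_subset)
  with *(3) show "inj_on (snd c) (fst c)"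
    by (auto simp: homeomorphic_map_def quotient_imp_surjective_map Int_absorb1)
qed

lemma chart_inv_left: "c \<in> A \<Longrightarrow> x \<in> fst c \<Longrightarrow> chart_inv c (snd c x) = x"
  unfolding chart_inv_def using chart_domain(4) by (simp add: inv_into_f_f)

lemma chart_inv_image: "c \<in> A \<Longrightarrow> y \<in> snd c ` fst c \<Longrightarrow> chart_inv c y \<in> fst c \<and> snd c (chart_inv c y) = y"
  by (auto simp: chart_inv_left)

lemma open_chart_image:
  assumes c: "c \<in> A" and U: "openin X U" "U \<subseteq> fst c"
  shows "open (snd c ` U)"
proof -
  have "open_map (subtopology X (fst c)) (top_of_set (snd c ` fst c)) (snd c)"
    using charts[OF c] by (simp add: is_chart_def homeomorphic_imp_open_map)
  moreover have "openin (subtopology X (fst c)) U"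
    using U by (metis inf.orderE openin_subtopology)
  ultimately have "openin (top_of_set (snd c ` fst c)) (snd c ` U)"
    by (auto simp: open_map_def)
  then show ?thesis
    using chart_domain(3)[OF c] openin_open_trans by blast
qed

lemma continuous_chart_inv:
  assumes c: "c \<in> A"
  shows "continuous_map (top_of_set (snd c ` fst c)) X (chart_inv c)"
  unfolding continuous_map
proof (intro conjI allI impI)
  show "chart_inv c ` topspace (top_of_set (snd c ` fst c)) \<subseteq> topspace X"
    using chart_inv_image[OF c] chart_domain(2)[OF c] by auto
  fix U assume U: "openin X U"
  have "{y \<in> topspace (top_of_set (snd c ` fst c)). chart_inv c y \<in> U} = snd c ` (U \<inter> fst c)"
    using chart_inv_left[OF c] chart_inv_image[OF c] by force
  moreover have "open (snd c ` (U \<inter> fst c))"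
    using U chart_domain[OF c] by (intro open_chart_image[OF c]) auto
  ultimately show "openin (top_of_set (snd c ` fst c)) {y \<in> topspace (top_of_set (snd c ` fst c)). chart_inv c y \<in> U}"
    by (auto intro: open_openin_trans[OF chart_domain(3)[OF c]])
qed

lemma smooth_map_id: "smooth_map X A X A id"
proof -
  have "smooth_on (snd c ` {x \<in> fst c. x \<in> fst c'}) (snd c' \<circ> chart_inv c)" if "c \<in> A" "c' \<in> A" for c c'
    using compatible[OF that] by (simp add: Int_def)
  then show ?thesis
    unfolding smooth_map_def by auto
qed

lemma has_local_derivative:
  assumes h: "smooth_map X A X A h" and c: "c \<in> A" "x \<in> fst c" and c': "c' \<in> A" "h x \<in> fst c'"
  shows "(snd c' \<circ> h \<circ> chart_inv c has_derivative local_derivative c c' h x) (at (snd c x))"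
  unfolding local_derivative_def
  using h c c' by (intro iffD1[OF frechet_derivative_works] smooth_on_differentiable)
    (auto simp: smooth_map_def)

lemma linear_local_derivative:
  assumes "smooth_map X A X A h" "c \<in> A" "x \<in> fst c" "c' \<in> A" "h x \<in> fst c'"
  shows "linear (local_derivative c c' h x)"
  using has_local_derivative[OF assms] by (rule has_derivative_linear)

text \<open>
  The coordinate expression of the composition agrees with the composition of the coordinate
  expressions only where \<open>h\<close> takes values in the domain of \<open>c'\<close>. This set is open, so the
  derivatives agree.
\<close>

lemma local_derivative_chain:
  assumes h: "smooth_map X A X A h" and g: "smooth_map X A X A g"
    and c: "c \<in> A" "x \<in> fst c" and c': "c' \<in> A" "h x \<in> fst c'" and c'': "c'' \<in> A" "g (h x) \<in> fst c''"
  shows "local_derivative c' c'' g (h x) (local_derivative c c' h x u) = local_derivative c c'' (g \<circ> h) x u"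
proof -
  let ?S = "snd c ` {z \<in> fst c. h z \<in> fst c'}"
  have "openin X {z \<in> topspace X. h z \<in> fst c'}"
    using h chart_domain(1)[OF c'(1)] by (auto simp: smooth_map_def intro: openin_continuous_map_preimage)
  then have "openin X ({z \<in> topspace X. h z \<in> fst c'} \<inter> fst c)"
    using chart_domain(1)[OF c(1)] by auto
  moreover have "{z \<in> topspace X. h z \<in> fst c'} \<inter> fst c = {z \<in> fst c. h z \<in> fst c'}"
    using chart_domain(2)[OF c(1)] by auto
  ultimately have S: "open ?S"
    by (intro open_chart_image[OF c(1)]) auto
  have "(snd c' \<circ> h \<circ> chart_inv c) (snd c x) = snd c' (h x)"
    using c by (simp add: chart_inv_left)
  then have "((snd c'' \<circ> g \<circ> chart_inv c') \<circ> (snd c' \<circ> h \<circ> chart_inv c) has_derivative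
      local_derivative c' c'' g (h x) \<circ> local_derivative c c' h x) (at (snd c x))"
    using has_local_derivative[OF h c c'] has_local_derivative[OF g c' c'']
    by (intro diff_chain_at) simp_all
  then have "(snd c'' \<circ> (g \<circ> h) \<circ> chart_inv c has_derivative
      local_derivative c' c'' g (h x) \<circ> local_derivative c c' h x) (at (snd c x))"
    using S by (rule has_derivative_transform_within_open)
      (use c c' in \<open>auto simp: chart_inv_left\<close>)
  then show ?thesis
    using frechet_derivative_at[of "snd c'' \<circ> (g \<circ> h) \<circ> chart_inv c"]
    unfolding local_derivative_def[of c c'' "g \<circ> h"] by (metis comp_apply)
qed

lemma coord_vector_tangent:
  assumes c: "c \<in> A" "x \<in> fst c"
  shows "coord_vector A c x u \<in> tangent_space A x"
  unfolding tangent_space_def coord_vector_def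
  using local_derivative_chain[OF smooth_map_id smooth_map_id c]
  by (auto simp: transition_derivative_eq)

lemma coord_vector_linear:
  assumes c: "c \<in> A" "x \<in> fst c"
  shows "coord_vector A c x (a *\<^sub>R u + b *\<^sub>R w)
    = (\<lambda>c'. a *\<^sub>R coord_vector A c x u c' + b *\<^sub>R coord_vector A c x w c')"
  using linear_local_derivative[OF smooth_map_id c]
  by (auto simp: coord_vector_def transition_derivative_eq fun_eq_iff linear_add linear_scale)

text \<open>
  The differential is computed in an arbitrarily chosen chart around \<open>x\<close>; by the chain rule any
  other chart \<open>c\<close> gives the same vector.
\<close>

lemma differential_coord_vector:
  assumes h: "smooth_map X A X A h" and c: "c \<in> A" "x \<in> fst c" and c': "c' \<in> A" "h x \<in> fst c'"
  shows "differential A A h x (coord_vector A c x u) = coord_vector A c' (h x) (local_derivative c c' h x u)"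
proof -
  define c0 where "c0 = (SOME c. c \<in> A \<and> x \<in> fst c)"
  have c0: "c0 \<in> A" "x \<in> fst c0"
    using someI[of "\<lambda>c. c \<in> A \<and> x \<in> fst c" c] c by (auto simp: c0_def)
  have "local_derivative c0 c'' h x (local_derivative c c0 id x u)
      = local_derivative c' c'' id (h x) (local_derivative c c' h x u)"
    if c'': "c'' \<in> A" "h x \<in> fst c''" for c''
    using local_derivative_chain[OF smooth_map_id h c, of c0 c'' u]
      local_derivative_chain[OF h smooth_map_id c c' c''(1), of u] c0 c'' by simp
  moreover have "differential A A h x v
      = (\<lambda>c'. if c' \<in> A \<and> h x \<in> fst c' then local_derivative c0 c' h x (v c0) else 0)" for v
    by (rule ext) (simp add: differential_def Let_def local_derivative_def c0_def)
  ultimately show ?thesis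
    using c0 by (intro ext) (simp add: coord_vector_def transition_derivative_eq)
qed

text \<open>
  In charts the differential of the identity is the derivative of a transition map; that it returns
  \<open>v\<close> is the compatibility of the components of a tangent vector.
\<close>

lemma differential_id:
  assumes x: "x \<in> topspace X" and v: "v \<in> tangent_space A x"
  shows "differential A A id x v = v"
proof -
  define c0 where "c0 = (SOME c. c \<in> A \<and> x \<in> fst c)"
  obtain c where "c \<in> A \<and> x \<in> fst c" using x covering by blast
  then have c0: "c0 \<in> A" "x \<in> fst c0"
    using someI[of "\<lambda>c. c \<in> A \<and> x \<in> fst c" c] by (auto simp: c0_def)
  have eq: "transition_derivative c0 c' x (v c0) = v c'" if "c' \<in> A" "x \<in> fst c'" for c'
    using conjunct2[OF v[unfolded tangent_space_def mem_Collect_eq], rule_format, OF c0(1) that(1) c0(2) that(2)] ..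
  have zero: "v c' = 0" if "\<not> (c' \<in> A \<and> x \<in> fst c')" for c'
    using conjunct1[OF v[unfolded tangent_space_def mem_Collect_eq]] that by metis
  have "differential A A id x v
      = (\<lambda>c'. if c' \<in> A \<and> x \<in> fst c' then transition_derivative c0 c' x (v c0) else 0)"
    by (rule ext) (simp add: differential_def Let_def transition_derivative_def c0_def)
  then show ?thesis
    using eq zero by (intro ext) simp
qed

end

section \<open>Wedge powers\<close>

text \<open>
  The map \<open>C\<close> turns coordinates into tangent vectors. Since it is applied entry by entry, it
  commutes with permutations, and the wedge product becomes an antisymmetrized tensor product on
  coordinate vectors.
\<close>

lemma wedge_map:
  assumes "length us = k + l"
  shows "wedge k l \<alpha> \<beta> x (map C us)
    = antisymmetrization (k + l) (\<lambda>us. \<alpha> x (map C (take k us)) * \<beta> x (map C (drop k us))) us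
      / (fact k * fact l)"
proof -
  have "permute_list \<sigma> (map C us) = map C (permute_list \<sigma> us)" if "\<sigma> permutes {..<k + l}" for \<sigma>
    using that assms by (simp add: permute_list_map)
  then show ?thesis
    by (simp add: wedge_def antisymmetrization_def take_map drop_map mult.assoc)
qed

text \<open>
  Here \<open>D\<close> is the differential of a map at \<open>x\<close> and \<open>y\<close> is the image point; the set \<open>V\<close>
  is the tangent space on which the scaling of \<open>\<omega>\<close> is known. Each of the \<open>j\<close> factors
  \<open>\<omega>\<close> contributes a factor \<open>a\<close>.
\<close>

lemma wedge_power_pullback:
  assumes "\<And>vs. length vs = 2 \<Longrightarrow> set vs \<subseteq> V \<Longrightarrow> \<omega> y (map D vs) = a * \<omega> x vs"
    and "length vs = 2 * j" and "set vs \<subseteq> V"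
  shows "wedge_power 2 \<omega> j y (map D vs) = a ^ j * wedge_power 2 \<omega> j x vs"
  using assms(2,3)
proof (induction j arbitrary: vs)
  case (Suc j)
  let ?p = "\<lambda>\<sigma>. permute_list \<sigma> vs"
  have "antisymmetrization (2 + 2 * j) (\<lambda>us. \<omega> y (map D (take 2 us)) * wedge_power 2 \<omega> j y (map D (drop 2 us))) vs
    = a ^ Suc j * antisymmetrization (2 + 2 * j) (\<lambda>us. \<omega> x (map id (take 2 us)) * wedge_power 2 \<omega> j x (map id (drop 2 us))) vs"
    unfolding antisymmetrization_def sum_distrib_left
  proof (rule sum.cong[OF refl])
    fix \<sigma> assume "\<sigma> \<in> {\<sigma>. \<sigma> permutes {..<2 + 2 * j}}"
    then have \<sigma>: "set (?p \<sigma>) \<subseteq> V" "length (?p \<sigma>) = 2 + 2 * j" using Suc.prems by auto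
    then have "set (take 2 (?p \<sigma>)) \<subseteq> V" "set (drop 2 (?p \<sigma>)) \<subseteq> V"
      by (meson order_trans set_take_subset set_drop_subset)+
    then show "of_int (sign \<sigma>) * (\<omega> y (map D (take 2 (?p \<sigma>))) * wedge_power 2 \<omega> j y (map D (drop 2 (?p \<sigma>))))
       = a ^ Suc j * (of_int (sign \<sigma>) * (\<omega> x (map id (take 2 (?p \<sigma>))) * wedge_power 2 \<omega> j x (map id (drop 2 (?p \<sigma>)))))"
      using \<sigma> Suc.IH[of "drop 2 (?p \<sigma>)"] assms(1)[of "take 2 (?p \<sigma>)"] by simp
  qed
  then show ?case
    using Suc.prems wedge_map[of vs 2 "2 * j" \<omega> "wedge_power 2 \<omega> j" y D]
      wedge_map[of vs 2 "2 * j" \<omega> "wedge_power 2 \<omega> j" x id] by simp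
qed simp

lemma multilinear_cong:
  assumes "\<And>us. length us = k \<Longrightarrow> T us = T' us" and "multilinear k T'"
  shows "multilinear k T"
  using assms by (simp add: multilinear_def)

lemma multilinear_multc: "multilinear k T \<Longrightarrow> multilinear k (\<lambda>us. T us * c)"
  by (simp add: multilinear_def linear_multc)

lemma multilinear_wedge_power:
  assumes "multilinear 2 (\<lambda>us. \<omega> x (map C us))"
  shows "multilinear (2 * j) (\<lambda>us. wedge_power 2 \<omega> j x (map C us))"
proof (induction j)
  case 0
  then show ?case by (simp add: multilinear_def)
next
  case (Suc j)
  have "multilinear (2 + 2 * j) (\<lambda>us. wedge_power 2 \<omega> (Suc j) x (map C us))"
    by (rule multilinear_cong[OF _ multilinear_multc[OF multilinear_antisymmetrization
      [OF multilinear_tensor[OF assms Suc.IH]], of "1 / (fact 2 * fact (2 * j))"]])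
      (simp add: wedge_map)
  then show ?case by simp
qed

lemma coord_frame_indices: "distinct (sorted_list_of_set (UNIV :: 'n::{finite,wellorder} set))"
  "set (sorted_list_of_set (UNIV :: 'n::{finite,wellorder} set)) = UNIV"
  by simp_all

lemma length_coord_frame: "length (coord_frame :: (real ^ 'n::{finite,wellorder}) list) = CARD('n)"
  by (simp add: coord_frame_def)

text \<open>
  In top degree, \<open>\<omega>\<^sup>d\<close> is the antisymmetrization of a multilinear form, hence a multiple of
  the determinant.
\<close>

lemma wedge_power_linear_image:
  fixes L :: "real ^ 'n::{finite,wellorder} \<Rightarrow> real ^ 'n::_"
  assumes \<omega>: "multilinear 2 (\<lambda>us. \<omega> x (map C us))" and d: "CARD('n) = 2 * d" and L: "linear L"
  shows "wedge_power 2 \<omega> d x (map C (map L coord_frame))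
    = det (matrix L) * wedge_power 2 \<omega> d x (map C coord_frame)"
proof -
  \<comment> \<open>Antisymmetrization comes from the outermost wedge product, so one factor is split off. It exists
    because the dimension is positive.\<close>
  have "0 < CARD('n)" by simp
  then obtain j where j: "d = Suc j" using d by (cases d) auto
  then have n: "CARD('n) = 2 + 2 * j" using d by simp
  let ?T = "\<lambda>us :: (real ^ 'n::_) list. \<omega> x (map C (take 2 us)) * wedge_power 2 \<omega> j x (map C (drop 2 us))"
  have "multilinear (CARD('n)) ?T"
    unfolding n by (rule multilinear_tensor[OF \<omega> multilinear_wedge_power[of \<omega> x C, OF \<omega>]])
  from antisymmetrization_linear_image[OF this L coord_frame_indices]
  have "antisymmetrization (2 + 2 * j) ?T (map L coord_frame)
      = det (matrix L) * antisymmetrization (2 + 2 * j) ?T coord_frame"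
    by (simp add: coord_frame_def n o_def)
  moreover have "wedge_power 2 \<omega> d x (map C us) = antisymmetrization (2 + 2 * j) ?T us / (fact 2 * fact (2 * j))"
    if "length us = CARD('n)" for us
    using that wedge_map[of us 2 "2 * j"] by (simp add: j n)
  ultimately show ?thesis
    by (simp add: length_coord_frame del: map_map)
qed

context smooth_manifold
begin

lemma local_form_chart: "c \<in> A \<Longrightarrow> x \<in> fst c \<Longrightarrow> local_form A c \<mu> us (snd c x) = \<mu> x (map (coord_vector A c x) us)"
  by (simp add: local_form_def chart_inv_left)

lemma continuous_local_form_wedge_power:
  assumes \<omega>: "differential_form X A 2 \<omega>" and c: "c \<in> A"
    and us: "length us = 2 * j"
  shows "continuous_on (snd c ` fst c) (local_form A c (wedge_power 2 \<omega> j) us)"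
  using us
proof (induction j arbitrary: us)
  case 0
  then show ?case by (simp add: local_form_def)
next
  case (Suc j)
  have \<omega>c: "continuous_on (snd c ` fst c) (local_form A c \<omega> us)" if "length us = 2" for us
    using \<omega> c that Ck_on.simps(1) unfolding differential_form_def smooth_on_def by blast
  have "local_form A c (wedge_power 2 \<omega> (Suc j)) us = (\<lambda>y. (\<Sum>\<sigma> | \<sigma> permutes {..<2 + 2 * j}. of_int (sign \<sigma>) *
      (local_form A c \<omega> (take 2 (permute_list \<sigma> us)) y *
       local_form A c (wedge_power 2 \<omega> j) (drop 2 (permute_list \<sigma> us)) y)) / (fact 2 * fact (2 * j)))"
    using Suc.prems by (simp add: local_form_def wedge_map antisymmetrization_def fun_eq_iff del: fact_2)
  moreover have "continuous_on (snd c ` fst c) \<dots>"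
    using Suc.prems by (intro continuous_intros \<omega>c Suc.IH) auto
  ultimately show ?case by simp
qed

text \<open>
  The form is multilinear on tangent vectors, which are families of coordinate vectors; composing
  with the linear map \<open>coord_vector A c x\<close> gives a form on one coordinate space.
\<close>

lemma multilinear_two_form:
  assumes \<omega>: "differential_form X A 2 \<omega>" and c: "c \<in> A" "x \<in> fst c"
  shows "multilinear 2 (\<lambda>us. \<omega> x (map (coord_vector A c x) us))"
  unfolding multilinear_def
proof (intro allI impI)
  fix us :: "(real ^ 'n) list" and i assume us: "length us = 2" and i: "i < (2::nat)"
  let ?C = "coord_vector A c x"
  have "x \<in> topspace X" using c chart_domain(2) by blast
  then have "alternating_multilinear A 2 x (\<omega> x)"
    using \<omega> by (simp add: differential_form_def)
  moreover have "map ?C us \<in> tangent_lists A 2 x"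
    using us coord_vector_tangent[OF c] by (auto simp: tangent_lists_def)
  ultimately have "\<omega> x ((map ?C us)[i := (\<lambda>c'. a *\<^sub>R ?C v c' + b *\<^sub>R ?C w c')])
      = a * \<omega> x ((map ?C us)[i := ?C v]) + b * \<omega> x ((map ?C us)[i := ?C w])" for a b v w
    using i coord_vector_tangent[OF c] unfolding alternating_multilinear_def by blast
  then have *: "\<omega> x (map ?C (us[i := a *\<^sub>R v + b *\<^sub>R w]))
      = a * \<omega> x (map ?C (us[i := v])) + b * \<omega> x (map ?C (us[i := w]))" for a b v w
    using coord_vector_linear[OF c] by (simp add: map_update)
  show "linear (\<lambda>v. \<omega> x (map ?C (us[i := v])))"
    unfolding linear_iff using *[of 1 _ 1] *[of _ _ 0] by simp
qed

end

text \<open>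
  The transformation law of the coefficient of \<open>\<omega>\<^sup>d\<close>. The value of \<open>\<omega>\<^sup>d\<close> on the
  images of the coordinate frame under the differential is the determinant times the coefficient at
  \<open>h x\<close>, and by pullback it is \<open>a\<^sup>d\<close> times the coefficient at \<open>x\<close>.
\<close>

lemma wedge_power_density:
  fixes X :: "'m topology" and A :: "('m, 'n::{finite,wellorder}) chart set"
  assumes M: "smooth_manifold X A" and \<omega>: "differential_form X A 2 \<omega>" and d: "CARD('n) = 2 * d"
    and h: "smooth_map X A X A h"
    and pull: "\<And>vs. vs \<in> tangent_lists A 2 x \<Longrightarrow> pullback A A h \<omega> x vs = a * \<omega> x vs"
    and c: "c \<in> A" "x \<in> fst c" and c': "c' \<in> A" "h x \<in> fst c'"
  shows "det (matrix (local_derivative c c' h x)) * local_form A c' (wedge_power 2 \<omega> d) coord_frame (snd c' (h x))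
    = a ^ d * local_form A c (wedge_power 2 \<omega> d) coord_frame (snd c x)"
proof -
  interpret smooth_manifold X A by fact
  let ?C = "coord_vector A c x" and ?C' = "coord_vector A c' (h x)" and ?L = "local_derivative c c' h x"
  have "det (matrix ?L) * wedge_power 2 \<omega> d (h x) (map ?C' coord_frame)
      = wedge_power 2 \<omega> d (h x) (map ?C' (map ?L coord_frame))"
    using wedge_power_linear_image[of \<omega> "h x" ?C', OF multilinear_two_form[OF \<omega> c'] d linear_local_derivative[OF h c c']] ..
  also have "map ?C' (map ?L coord_frame) = map (differential A A h x) (map ?C coord_frame)"
    using differential_coord_vector[OF h c c'] by simp
  also have "wedge_power 2 \<omega> d (h x) \<dots> = a ^ d * wedge_power 2 \<omega> d x (map ?C coord_frame)"
    using pull coord_vector_tangent[OF c]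
    by (intro wedge_power_pullback[where V = "tangent_space A x"])
       (auto simp: tangent_lists_def pullback_def length_coord_frame d)
  finally show ?thesis
    using c c' by (simp add: local_form_chart)
qed

section \<open>Borel measures on a second countable space\<close>

text \<open>
  Images under injections respect complements and countable unions, so it suffices to know the
  images of the generators. This shows that charts and homeomorphisms map Borel sets to Borel sets.
\<close>

lemma sigma_sets_image:
  assumes E: "E \<in> sigma_sets \<Omega> G" and W: "W \<subseteq> \<Omega>" "inj_on s W" "s ` W \<in> sets N"
    and G: "\<And>U. U \<in> G \<Longrightarrow> s ` (U \<inter> W) \<in> sets N"
  shows "s ` (E \<inter> W) \<in> sets N"
  using E
proof induction
  case (Compl E)
  have "s ` ((\<Omega> - E) \<inter> W) = s ` W - s ` (E \<inter> W)"
    using W by (auto simp: inj_on_def)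
  then show ?case using Compl W by simp
next
  case (Union F)
  have "s ` (\<Union> (range F) \<inter> W) = (\<Union>i. s ` (F i \<inter> W))" by auto
  then show ?case using Union by auto
qed (use G in auto)

lemma borel_sets_of_sigma: "borel_sets_of X = sets (sigma (topspace X) {U. openin X U})"
  using openin_subset by (subst sets_measure_of) (auto simp: borel_sets_of_def)

lemma sigma_algebra_borel_sets_of: "sigma_algebra (topspace X) (borel_sets_of X)"
  unfolding borel_sets_of_def using openin_subset by (intro sigma_algebra_sigma_sets) auto

lemma openin_borel: "openin X U \<Longrightarrow> U \<in> borel_sets_of X"
  by (simp add: borel_sets_of_def sigma_sets.Basic)

lemma closedin_borel:
  assumes "closedin X L" shows "L \<in> borel_sets_of X"
proof -
  have "topspace X - (topspace X - L) \<in> borel_sets_of X"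
    unfolding borel_sets_of_def using assms by (intro sigma_sets.Compl sigma_sets.Basic) auto
  then show ?thesis
    using closedin_subset[OF assms] by (simp add: double_diff)
qed

lemma borel_sets_of_subset: "E \<in> borel_sets_of X \<Longrightarrow> E \<subseteq> topspace X"
  unfolding borel_sets_of_def by (rule sigma_sets_into_sp[rotated]) (auto dest: openin_subset)

text \<open>
  The Lindelof property, for an indexed cover and with the countable subcover arranged as a sequence.
\<close>

lemma countable_cover_sequence:
  assumes X: "second_countable X" "topspace X \<noteq> {}" and cov: "\<And>x. x \<in> topspace X \<Longrightarrow> \<exists>i\<in>I. x \<in> U i"
    and op: "\<And>i. i \<in> I \<Longrightarrow> openin X (U i)"
  obtains s :: "nat \<Rightarrow> 'i" where "\<And>n. s n \<in> I" "(\<Union>n. U (s n)) = topspace X"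
proof -
  have "\<And>W. W \<in> U ` I \<Longrightarrow> openin X W" using op by auto
  moreover have "\<Union> (U ` I) = topspace X"
    using cov op openin_subset by blast
  ultimately obtain \<V> where \<V>: "countable \<V>" "\<V> \<subseteq> U ` I" "\<Union>\<V> = topspace X"
    using Lindelof_spaceD[OF second_countable_imp_Lindelof_space[OF X(1)], of "U ` I"] by metis
  then have ne: "\<V> \<noteq> {}" using X(2) by (metis Union_empty)
  then have r: "range (from_nat_into \<V>) = \<V>"
    using \<V>(1) by (rule range_from_nat_into)
  then have "\<forall>n. \<exists>i\<in>I. from_nat_into \<V> n = U i" using \<V>(2) by (metis imageE rangeI subsetD)
  then obtain s where s: "\<And>n. s n \<in> I" "\<And>n. from_nat_into \<V> n = U (s n)" by metis
  then have "(\<Union>n. U (s n)) = topspace X" using r \<V>(3) by (metis (no_types, lifting) image_cong)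
  with s(1) show thesis by (rule that)
qed

text \<open>
  Measures that agree locally are equal, because every Borel set is a countable disjoint union of
  Borel sets that each lie in one member of the cover.
\<close>

lemma measure_eqI_open_cover:
  assumes X: "second_countable X"
    and N: "sets N = borel_sets_of X" "sets N' = borel_sets_of X"
    and cov: "\<And>x. x \<in> topspace X \<Longrightarrow> \<exists>i\<in>I. x \<in> U i"
    and op: "\<And>i. i \<in> I \<Longrightarrow> openin X (U i)"
    and eq: "\<And>i E. i \<in> I \<Longrightarrow> E \<in> borel_sets_of X \<Longrightarrow> E \<subseteq> U i \<Longrightarrow> emeasure N E = emeasure N' E"
  shows "N = N'"
proof (rule measure_eqI)
  show "sets N = sets N'" using N by simp
  fix E assume E: "E \<in> sets N"
  show "emeasure N E = emeasure N' E"
  proof (cases "topspace X = {}")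
    case True
    then have "E = {}" using E N borel_sets_of_subset by fastforce
    then show ?thesis by simp
  next
    case False
    obtain s :: "nat \<Rightarrow> 'b" where s: "\<And>n. s n \<in> I" "(\<Union>n. U (s n)) = topspace X"
      using countable_cover_sequence[OF X False cov op] by metis
    define F where "F n = E \<inter> disjointed (\<lambda>n. U (s n)) n" for n
    have "range (\<lambda>n. U (s n)) \<subseteq> sets N"
      by (simp add: image_subset_iff op s(1) openin_borel N(1))
    from sets.range_disjointed_sets[OF this]
    have D: "disjointed (\<lambda>n. U (s n)) n \<in> sets N" for n by blast
    then have "F n \<in> sets N" for n
      unfolding F_def using E by (rule sets.Int[rotated])
    then have F: "range F \<subseteq> sets N" "range F \<subseteq> sets N'"
      using N by auto
    have disj: "disjoint_family F"
      using disjoint_family_disjointed[of "\<lambda>n. U (s n)"] by (auto simp: F_def disjoint_family_on_def)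
    have "(\<Union>n. F n) = E \<inter> (\<Union>n. disjointed (\<lambda>n. U (s n)) n)" by (auto simp: F_def)
    also have "\<dots> = E"
      using borel_sets_of_subset[of E X] E N s(2) by (simp add: UN_disjointed_eq Int_absorb2)
    finally have UF: "(\<Union>n. F n) = E" .
    have "F n \<subseteq> U (s n)" for n
      using disjointed_subset[of "\<lambda>n. U (s n)" n] by (auto simp: F_def)
    then have "emeasure N (F n) = emeasure N' (F n)" for n
      using eq[OF s(1), of "F n"] F N by blast
    then show ?thesis
      using suminf_emeasure[OF F(1) disj] suminf_emeasure[OF F(2) disj] UF by simp
  qed
qed

section \<open>The measure with given densities in the charts\<close>

text \<open>
  A density: one nonnegative function per chart, where coordinate changes multiply by the absolute
  value of the Jacobian. The absolute value of the coefficient of any continuous form of top degree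
  is an example.
\<close>

locale chart_density = smooth_manifold X A
  for X :: "'m topology" and A :: "('m, 'n::{finite,wellorder}) chart set" +
  fixes g :: "('m, 'n) chart \<Rightarrow> real ^ 'n::_ \<Rightarrow> real"
  assumes density_nonneg: "0 \<le> g c y"
    and density_continuous: "c \<in> A \<Longrightarrow> continuous_on (snd c ` fst c) (g c)"
    and density_transition: "c \<in> A \<Longrightarrow> c' \<in> A \<Longrightarrow> x \<in> fst c \<Longrightarrow> x \<in> fst c' \<Longrightarrow>
      \<bar>det (matrix (local_derivative c c' id x))\<bar> * g c' (snd c' x) = g c (snd c x)"
begin

definition chart_measure :: "('m, 'n) chart \<Rightarrow> 'm set \<Rightarrow> ennreal" where
  "chart_measure c E = (\<integral>\<^sup>+y\<in>snd c ` E. ennreal (g c y) \<partial>lborel)"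

lemma chart_image_borel:
  assumes c: "c \<in> A" and E: "E \<in> borel_sets_of X" "E \<subseteq> fst c"
  shows "snd c ` E \<in> sets borel"
proof -
  have "snd c ` (E \<inter> fst c) \<in> sets borel"
    using E(1) unfolding borel_sets_of_def
  proof (rule sigma_sets_image)
    fix U assume "U \<in> {U. openin X U}"
    then have "open (snd c ` (U \<inter> fst c))"
      using chart_domain(1)[OF c] by (intro open_chart_image[OF c]) auto
    then show "snd c ` (U \<inter> fst c) \<in> sets borel" by simp
  qed (use chart_domain[OF c] in auto)
  then show ?thesis using E(2) by (simp add: Int_absorb2)
qed

lemma density_measurable:
  assumes c: "c \<in> A"
  shows "(\<lambda>y. indicator (snd c ` fst c) y * g c y) \<in> borel_measurable borel"
  using borel_measurable_continuous_on_indicator[OF _ density_continuous[OF c]] chart_domain(3)[OF c] by simp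

text \<open>
  The change of variables formula for \<open>h\<close> in charts. With \<open>h = id\<close> it says that the measures
  defined by two charts agree on the overlap; with a volume-scaling \<open>h\<close> it gives the scaling of
  measures.
\<close>

lemma chart_measure_image:
  assumes h: "smooth_map X A X A h" and inj: "inj_on h E" and c: "c \<in> A" and c': "c' \<in> A"
    and E: "E \<in> borel_sets_of X" "E \<subseteq> fst c" "h ` E \<subseteq> fst c'"
    and k: "0 \<le> k" and law: "\<And>x. x \<in> E \<Longrightarrow>
      \<bar>det (matrix (local_derivative c c' h x))\<bar> * g c' (snd c' (h x)) = k * g c (snd c x)"
  shows "chart_measure c' (h ` E) = ennreal k * chart_measure c E"
proof -
  let ?\<phi> = "snd c' \<circ> h \<circ> chart_inv c"
  \<comment> \<open>The density is known to be measurable only on the image of the chart; the indicator cuts off its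
    arbitrary values elsewhere.\<close>
  let ?G = "\<lambda>y. k * (indicator (snd c ` fst c) y * g c y)"
  have inv: "chart_inv c (snd c x) = x" if "x \<in> E" for x
    using that E(2) chart_inv_left[OF c] by auto
  have im: "?\<phi> ` snd c ` E = snd c' ` h ` E"
    using inv by (force simp: image_iff)
  have "chart_measure c' (h ` E) = (\<integral>\<^sup>+y\<in>snd c ` E. ennreal (?G y) \<partial>lborel)"
    unfolding chart_measure_def im[symmetric]
  proof (rule nn_integral_change_of_variables[where \<phi>' = "\<lambda>y. local_derivative c c' h (chart_inv c y)"])
    show "snd c ` E \<in> sets borel" using c E by (intro chart_image_borel)
    show "inj_on ?\<phi> (snd c ` E)"
    proof (rule inj_onI)
      fix y z assume "y \<in> snd c ` E" "z \<in> snd c ` E" and eq: "?\<phi> y = ?\<phi> z"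
      then obtain p q where pq: "p \<in> E" "q \<in> E" "y = snd c p" "z = snd c q" by auto
      then have "h p \<in> fst c'" "h q \<in> fst c'" using E(3) by auto
      with eq pq have "h p = h q"
        using chart_domain(4)[OF c'] inv by (simp add: inj_on_eq_iff)
      then show "y = z" using inj pq by (simp add: inj_on_eq_iff)
    qed
    show "?G \<in> borel_measurable borel" using density_measurable[OF c] by measurable
  next
    fix y assume "y \<in> snd c ` E"
    then obtain x where x: "x \<in> E" "y = snd c x" by auto
    then have xc: "x \<in> fst c" "h x \<in> fst c'" using E by auto
    show "(?\<phi> has_derivative local_derivative c c' h (chart_inv c y)) (at y)"
      using has_local_derivative[OF h c xc(1) c' xc(2)] x inv by simp
    show "\<bar>det (matrix (local_derivative c c' h (chart_inv c y)))\<bar> * g c' (?\<phi> y) = ?G y"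
      using law[OF x(1)] x xc inv by simp
  qed (rule density_nonneg)
  also have "\<dots> = (\<integral>\<^sup>+y. ennreal k * (ennreal (indicator (snd c ` fst c) y * g c y) * indicator (snd c ` E) y) \<partial>lborel)"
    using k density_nonneg by (intro nn_integral_cong) (simp add: ennreal_mult' mult.assoc)
  also have "\<dots> = ennreal k * (\<integral>\<^sup>+y\<in>snd c ` E. ennreal (indicator (snd c ` fst c) y * g c y) \<partial>lborel)"
    using density_measurable[OF c] chart_image_borel[OF c E(1,2)]
    by (intro nn_integral_cmult borel_measurable_times_ennreal borel_measurable_indicator
        measurable_compose[OF _ measurable_ennreal]) auto
  also have "(\<integral>\<^sup>+y\<in>snd c ` E. ennreal (indicator (snd c ` fst c) y * g c y) \<partial>lborel) = chart_measure c E"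
    unfolding chart_measure_def using E(2) by (intro nn_integral_cong) (auto simp: indicator_def)
  finally show ?thesis .
qed

lemma chart_measure_overlap:
  assumes "c \<in> A" "c' \<in> A" "E \<in> borel_sets_of X" "E \<subseteq> fst c" "E \<subseteq> fst c'"
  shows "chart_measure c' E = chart_measure c E"
  using chart_measure_image[OF smooth_map_id, of E c c' 1] assms density_transition[OF assms(1,2)]
  by (simp add: subset_iff)

lemma chart_measure_Union:
  fixes F :: "nat \<Rightarrow> 'm set"
  assumes c: "c \<in> A" and F: "\<And>n. F n \<in> borel_sets_of X" "\<And>n. F n \<subseteq> fst c" and disj: "disjoint_family F"
  shows "chart_measure c (\<Union>n. F n) = (\<Sum>n. chart_measure c (F n))"
proof -
  let ?g = "\<lambda>y. ennreal (indicator (snd c ` fst c) y * g c y)"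
  have g: "?g \<in> borel_measurable lborel"
    using density_measurable[OF c] by measurable
  have eq: "chart_measure c E = emeasure (density lborel ?g) (snd c ` E)"
    if "E \<subseteq> fst c" "E \<in> borel_sets_of X" for E
  proof -
    have "emeasure (density lborel ?g) (snd c ` E) = (\<integral>\<^sup>+y\<in>snd c ` E. ?g y \<partial>lborel)"
      using chart_image_borel[OF c that(2,1)] g by (simp add: emeasure_density)
    also have "\<dots> = chart_measure c E"
      unfolding chart_measure_def using that by (intro nn_integral_cong) (auto simp: indicator_def)
    finally show ?thesis by simp
  qed
  interpret S: sigma_algebra "topspace X" "borel_sets_of X" by (rule sigma_algebra_borel_sets_of)
  have "disjoint_family (\<lambda>n. snd c ` F n)"
    unfolding disjoint_family_on_def
  proof (intro ballI impI)
    fix m n :: nat assume "m \<noteq> n"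
    then have "F m \<inter> F n = {}" using disj by (auto simp: disjoint_family_on_def)
    then show "snd c ` F m \<inter> snd c ` F n = {}"
      using inj_on_image_Int[OF chart_domain(4)[OF c] F(2)[of m] F(2)[of n]] by simp
  qed
  then have "(\<Sum>n. emeasure (density lborel ?g) (snd c ` F n)) = emeasure (density lborel ?g) (\<Union>n. snd c ` F n)"
    using chart_image_borel[OF c F] by (intro suminf_emeasure) auto
  moreover have "(\<Union>n. F n) \<in> borel_sets_of X" "(\<Union>n. F n) \<subseteq> fst c" using F by auto
  ultimately show ?thesis
    using eq F by (simp add: image_UN)
qed

text \<open>
  For \<open>g\<close> the absolute value of the coefficient of a form of top degree, this is the property
  whose definite description is the measure of the form.
\<close>

definition chart_compatible :: "'m measure \<Rightarrow> bool" where
  "chart_compatible N \<longleftrightarrow> space N = topspace X \<and> sets N = borel_sets_of X \<and>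
     (\<forall>c\<in>A. \<forall>E\<in>borel_sets_of X. E \<subseteq> fst c \<longrightarrow> emeasure N E = chart_measure c E)"

text \<open>
  The manifold is cut into countably many disjoint Borel pieces \<open>D n\<close>, each in the domain of a
  chart \<open>s n\<close>, and each piece is measured in its chart. On subsets of the domain of any other
  chart \<open>c\<close> this gives the measure of \<open>c\<close>, since the chart measures agree on overlaps.
\<close>

lemma chart_compatible_exists:
  assumes ne: "topspace X \<noteq> {}"
  shows "\<exists>N. chart_compatible N"
proof -
  interpret S: sigma_algebra "topspace X" "borel_sets_of X" by (rule sigma_algebra_borel_sets_of)
  obtain s :: "nat \<Rightarrow> ('m, 'n) chart" where s: "\<And>n. s n \<in> A" "(\<Union>n. fst (s n)) = topspace X"
  proof (rule countable_cover_sequence[OF second_countable ne, of A fst])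
    show "\<exists>c\<in>A. x \<in> fst c" if "x \<in> topspace X" for x using that covering by blast
  qed (use chart_domain(1) in auto)
  define D where "D = disjointed (\<lambda>n. fst (s n))"
  have "range (\<lambda>n. fst (s n)) \<subseteq> borel_sets_of X"
    using chart_domain(1)[OF s(1)] openin_borel by blast
  from S.range_disjointed_sets[OF this]
  have D: "D n \<in> borel_sets_of X" for n unfolding D_def by blast
  have Ds: "D n \<subseteq> fst (s n)" for n
    unfolding D_def by (rule disjointed_subset)
  have disj: "disjoint_family D" unfolding D_def by (rule disjoint_family_disjointed)
  have UD: "(\<Union>n. D n) = topspace X" unfolding D_def using s(2) by (simp add: UN_disjointed_eq)
  define \<mu> where "\<mu> E = (\<Sum>n. chart_measure (s n) (E \<inter> D n))" for E
  have "countably_additive (borel_sets_of X) \<mu>"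
    unfolding countably_additive_def
  proof (intro allI impI)
    fix F :: "nat \<Rightarrow> 'm set" assume F: "range F \<subseteq> borel_sets_of X" and dF: "disjoint_family F"
    have "chart_measure (s n) ((\<Union>i. F i) \<inter> D n) = (\<Sum>i. chart_measure (s n) (F i \<inter> D n))" for n
    proof -
      have "disjoint_family (\<lambda>i. F i \<inter> D n)"
        using dF by (auto simp: disjoint_family_on_def)
      then have "chart_measure (s n) (\<Union>i. F i \<inter> D n) = (\<Sum>i. chart_measure (s n) (F i \<inter> D n))"
        using F D Ds by (intro chart_measure_Union s) auto
      then show ?thesis by simp
    qed
    then have "\<mu> (\<Union>i. F i) = (\<Sum>n. \<Sum>i. chart_measure (s n) (F i \<inter> D n))"
      by (simp add: \<mu>_def)
    \<comment> \<open>A double series of nonnegative terms may be summed in either order: one of the sums is an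
      integral with respect to counting measure.\<close>
    also have "\<dots> = (\<Sum>i. \<Sum>n. chart_measure (s n) (F i \<inter> D n))"
      using nn_integral_suminf[of "\<lambda>i n. chart_measure (s n) (F i \<inter> D n)" "count_space UNIV"]
      by (simp add: nn_integral_count_space_nat)
    finally show "(\<Sum>i. \<mu> (F i)) = \<mu> (\<Union>i. F i)" by (simp add: \<mu>_def)
  qed
  moreover have "positive (borel_sets_of X) \<mu>"
    by (simp add: positive_def \<mu>_def chart_measure_def)
  moreover define N where "N = measure_of (topspace X) (borel_sets_of X) \<mu>"
  ultimately have N: "emeasure N E = \<mu> E" if "E \<in> borel_sets_of X" for E
    unfolding N_def using that by (intro emeasure_measure_of_sigma) (auto intro: sigma_algebra_borel_sets_of)
  have sp: "space N = topspace X"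
    unfolding N_def using S.space_closed by (simp add: space_measure_of_conv)
  have st: "sets N = borel_sets_of X"
    unfolding N_def using S.space_closed by (simp add: S.sigma_sets_eq)
  have "emeasure N E = chart_measure c E" if c: "c \<in> A" and E: "E \<in> borel_sets_of X" "E \<subseteq> fst c" for c E
  proof -
    have "emeasure N E = (\<Sum>n. chart_measure (s n) (E \<inter> D n))" using N E(1) by (simp add: \<mu>_def)
    also have "\<dots> = (\<Sum>n. chart_measure c (E \<inter> D n))"
      using E D Ds by (intro suminf_cong chart_measure_overlap[OF c s(1)]) auto
    also have "\<dots> = chart_measure c (\<Union>n. E \<inter> D n)"
      using disj E D by (intro chart_measure_Union[symmetric] c) (auto simp: disjoint_family_on_def)
    also have "(\<Union>n. E \<inter> D n) = E" using UD E(1) borel_sets_of_subset[of E X] by auto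
    finally show ?thesis .
  qed
  with sp st show ?thesis unfolding chart_compatible_def by blast
qed

lemma chart_compatible_unique:
  assumes N: "chart_compatible N" "chart_compatible N'"
  shows "N = N'"
proof (rule measure_eqI_open_cover[OF second_countable, of N N' A fst])
  show "\<exists>c\<in>A. x \<in> fst c" if "x \<in> topspace X" for x using that covering by blast
qed (use N chart_domain(1) in \<open>auto simp: chart_compatible_def\<close>)

lemma chart_compatible_The:
  assumes "topspace X \<noteq> {}"
  shows "chart_compatible (THE N. chart_compatible N)"
  using chart_compatible_exists[OF assms] chart_compatible_unique by (metis theI)

text \<open>
  Take for \<open>L\<close> a closed ball in the image of a chart, where the continuous density is bounded.
\<close>

lemma finite_compact_neighbourhood:
  assumes N: "chart_compatible N" and x: "x \<in> topspace X"
  obtains V L where "openin X V" "x \<in> V" "V \<subseteq> L" "compactin X L" "emeasure N L < \<infinity>"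
proof -
  obtain c where c: "c \<in> A" "x \<in> fst c" using x covering by blast
  then obtain r where r: "0 < r" "cball (snd c x) r \<subseteq> snd c ` fst c"
    using chart_domain(3)[OF c(1)] by (meson imageI open_contains_cball)
  let ?B = "cball (snd c x) r"
  define V where "V = {z \<in> fst c. snd c z \<in> ball (snd c x) r}"
  define L where "L = chart_inv c ` ?B"
  have cm: "continuous_map (subtopology X (fst c)) euclidean (snd c)"
    using charts[OF c(1)] by (auto simp: is_chart_def dest!: homeomorphic_imp_continuous_map continuous_map_into_fulltopology)
  then have "openin (subtopology X (fst c)) {z \<in> topspace (subtopology X (fst c)). snd c z \<in> ball (snd c x) r}"
    by (rule openin_continuous_map_preimage) auto
  moreover have "{z \<in> topspace (subtopology X (fst c)). snd c z \<in> ball (snd c x) r} = V"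
    using chart_domain(2)[OF c(1)] by (auto simp: V_def)
  ultimately have V: "openin X V"
    using chart_domain(1)[OF c(1)] openin_trans_full by metis
  have VL: "V \<subseteq> L"
  proof
    fix z assume "z \<in> V"
    then have "z = chart_inv c (snd c z)" "snd c z \<in> ?B"
      using chart_inv_left[OF c(1)] by (auto simp: V_def)
    then show "z \<in> L" unfolding L_def by blast
  qed
  have "compactin (top_of_set (snd c ` fst c)) ?B"
    using r by (simp add: compactin_subtopology)
  then have L: "compactin X L"
    unfolding L_def using continuous_chart_inv[OF c(1)] by (rule image_compactin)
  have "closedin X L" using Hausdorff L by (rule compactin_imp_closedin)
  then have LB: "L \<in> borel_sets_of X" by (rule closedin_borel)
  have Lc: "L \<subseteq> fst c" and sL: "snd c ` L = ?B"
    using r chart_inv_image[OF c(1)] by (force simp: L_def image_image)+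
  have "bdd_above (g c ` ?B)"
    using r by (intro bounded_imp_bdd_above compact_imp_bounded compact_continuous_image
        continuous_on_subset[OF density_continuous[OF c(1)]]) auto
  then obtain b where b: "\<And>y. y \<in> ?B \<Longrightarrow> g c y \<le> b"
    unfolding bdd_above_def by blast
  have "emeasure N L = (\<integral>\<^sup>+y\<in>?B. ennreal (g c y) \<partial>lborel)"
    using N c(1) LB Lc sL by (simp add: chart_compatible_def chart_measure_def)
  also have "\<dots> \<le> (\<integral>\<^sup>+y. ennreal b * indicator ?B y \<partial>lborel)"
    using b by (intro nn_integral_mono) (auto simp: indicator_def intro: ennreal_leI)
  also have "\<dots> = ennreal b * emeasure lborel ?B"
    by (simp add: nn_integral_cmult_indicator)
  also have "\<dots> < \<infinity>"
    using emeasure_compact_finite[of ?B] by (simp add: ennreal_mult_less_top)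
  finally show thesis using that V VL L r(1) c(2) by (auto simp: V_def)
qed

text \<open>
  The measures \<open>E \<mapsto> N (f E)\<close> and \<open>k N\<close> agree on every Borel set that lies in a chart domain
  and is mapped by \<open>f\<close> into a chart domain. The open sets with this property cover the manifold,
  so the measures are equal. The first measure is the image of \<open>N\<close> under the inverse of \<open>f\<close>.
\<close>

lemma emeasure_diffeomorphism_image:
  assumes N: "chart_compatible N" and f: "diffeomorphism X A X A f" and k: "0 < k"
    and law: "\<And>c c' x. c \<in> A \<Longrightarrow> c' \<in> A \<Longrightarrow> x \<in> fst c \<Longrightarrow> f x \<in> fst c' \<Longrightarrow>
      \<bar>det (matrix (local_derivative c c' f x))\<bar> * g c' (snd c' (f x)) = k * g c (snd c x)"
    and E: "E \<in> borel_sets_of X"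
  shows "f ` E \<in> borel_sets_of X" and "emeasure N (f ` E) = ennreal k * emeasure N E"
proof -
  let ?f' = "inv_into (topspace X) f"
  have bij: "bij_betw f (topspace X) (topspace X)" and f1: "smooth_map X A X A f" and f2: "smooth_map X A X A ?f'"
    using f by (auto simp: diffeomorphism_def)
  have inj: "inj_on f (topspace X)" and fim: "f ` topspace X = topspace X"
    using bij by (auto simp: bij_betw_def)
  have cf: "continuous_map X X f" "continuous_map X X ?f'"
    using f1 f2 by (auto simp: smooth_map_def)
  have pre: "{x \<in> topspace X. ?f' x \<in> B} = f ` B" if "B \<subseteq> topspace X" for B
    using that bij_betw_inv_into_right[OF bij] bij_betw_inv_into_left[OF bij] fim by (force simp: image_iff)
  have im: "f ` B \<in> borel_sets_of X" if B: "B \<in> borel_sets_of X" for B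
  proof -
    have "f ` (B \<inter> topspace X) \<in> sets (sigma (topspace X) {U. openin X U})"
      using B unfolding borel_sets_of_def
    proof (rule sigma_sets_image)
      show "f ` topspace X \<in> sets (sigma (topspace X) {U. openin X U})"
        using fim openin_borel[of X "topspace X"] by (simp add: borel_sets_of_sigma)
      fix U assume "U \<in> {U. openin X U}"
      then have U: "openin X U" by simp
      then have "openin X {x \<in> topspace X. ?f' x \<in> U}"
        using cf(2) by (intro openin_continuous_map_preimage)
      then have "openin X (f ` U)" using pre openin_subset[OF U] by simp
      then show "f ` (U \<inter> topspace X) \<in> sets (sigma (topspace X) {U. openin X U})"
        using openin_borel[of X] openin_subset[OF U] by (simp add: borel_sets_of_sigma Int_absorb2)
    qed (use inj in auto)
    then show ?thesis
      using borel_sets_of_subset[OF B] by (simp add: borel_sets_of_sigma Int_absorb2)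
  qed
  show "f ` E \<in> borel_sets_of X" using E by (rule im)
  have spN: "space N = topspace X" and stN: "sets N = borel_sets_of X"
    using N by (auto simp: chart_compatible_def)
  have meas: "?f' \<in> measurable N N"
  proof (rule measurableI)
    show "?f' x \<in> space N" if "x \<in> space N" for x
      using that fim spN by (simp add: inv_into_into)
    fix B assume B: "B \<in> sets N"
    then have "?f' -` B \<inter> space N = f ` B"
      using pre[of B] borel_sets_of_subset[of B X] spN stN by auto
    then show "?f' -` B \<inter> space N \<in> sets N" using im B stN by simp
  qed
  have dist: "emeasure (distr N N ?f') B = emeasure N (f ` B)" if "B \<in> borel_sets_of X" for B
    using that meas pre[OF borel_sets_of_subset[OF that]] stN spN
    by (simp add: emeasure_distr vimage_def Int_def conj_commute)
  have "distr N N ?f' = scale_measure (ennreal k) N"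
  proof (rule measure_eqI_open_cover[OF second_countable, where I = "A \<times> A"
        and U = "\<lambda>(c, c'). {x \<in> fst c. f x \<in> fst c'}"])
    show "\<exists>i\<in>A \<times> A. x \<in> (case i of (c, c') \<Rightarrow> {x \<in> fst c. f x \<in> fst c'})" if x: "x \<in> topspace X" for x
    proof -
      have "f x \<in> topspace X" using x fim by blast
      then obtain c c' where "c \<in> A" "x \<in> fst c" "c' \<in> A" "f x \<in> fst c'"
        using x covering by blast
      then show ?thesis by (intro bexI[of _ "(c, c')"]) auto
    qed
    fix i assume "i \<in> A \<times> A"
    then obtain c c' where i: "i = (c, c')" "c \<in> A" "c' \<in> A" by auto
    have "openin X ({x \<in> topspace X. f x \<in> fst c'} \<inter> fst c)"
      using chart_domain(1) i cf(1) by (intro openin_Int openin_continuous_map_preimage[of X X]) auto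
    moreover have "{x \<in> topspace X. f x \<in> fst c'} \<inter> fst c = {x \<in> fst c. f x \<in> fst c'}"
      using chart_domain(2)[OF i(2)] by auto
    ultimately show "openin X (case i of (c, c') \<Rightarrow> {x \<in> fst c. f x \<in> fst c'})"
      by (simp add: i)
    fix B assume B: "B \<in> borel_sets_of X" "B \<subseteq> (case i of (c, c') \<Rightarrow> {x \<in> fst c. f x \<in> fst c'})"
    then have Bc: "B \<subseteq> fst c" "f ` B \<subseteq> fst c'" by (auto simp: i)
    have "emeasure N (f ` B) = chart_measure c' (f ` B)"
      using N i Bc im[OF B(1)] by (simp add: chart_compatible_def)
    also have "\<dots> = ennreal k * chart_measure c B"
      using law[OF i(2,3)] Bc k inj_on_subset[OF inj borel_sets_of_subset[OF B(1)]]
      by (intro chart_measure_image f1 i B(1)) (auto simp: image_subset_iff)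
    also have "chart_measure c B = emeasure N B"
      using N i Bc B(1) by (simp add: chart_compatible_def)
    finally show "emeasure (distr N N ?f') B = emeasure (scale_measure (ennreal k) N) B"
      by (simp add: dist[OF B(1)])
  qed (simp_all add: stN)
  then show "emeasure N (f ` E) = ennreal k * emeasure N E"
    using dist[OF E] by simp
qed

end

section \<open>Contracted volumes and backward orbits\<close>

text \<open>
  The point \<open>f\<^sup>-\<^sup>n x\<close> lies in \<open>L j\<close> if and only if \<open>x\<close> lies in \<open>f\<^sup>n (L j)\<close>. A compact set
  that is visited infinitely often is covered by finitely many of the \<open>V j\<close>, so one of these is
  visited infinitely often. Equality, and not only inclusion, is what makes the set of such points
  measurable.
\<close>

lemma backward_nonescaping_eq_limsup:
  fixes L V :: "nat \<Rightarrow> 'm set"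
  assumes bij: "bij_betw f (topspace X) (topspace X)"
    and V: "\<And>j. openin X (V j)" "(\<Union>j. V j) = topspace X"
    and L: "\<And>j. V j \<subseteq> L j" "\<And>j. compactin X (L j)"
  shows "backward_nonescaping X f = (\<Union>j. limsup (\<lambda>n. (f ^^ n) ` L j))"
proof -
  let ?b = "\<lambda>n. inv_into (topspace X) f ^^ n"
  have bijn: "bij_betw (f ^^ n) (topspace X) (topspace X)" for n
    using bij by (rule bij_betw_funpow)
  have b: "(f ^^ n) (?b n x) = x" "?b n x \<in> topspace X" if "x \<in> topspace X" for n x
  proof -
    have "?b n x \<in> topspace X \<and> (f ^^ n) (?b n x) = x"
      using that
    proof (induction n arbitrary: x)
      case (Suc n)
      let ?y = "inv_into (topspace X) f x"
      have y: "?y \<in> topspace X" "f ?y = x"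
        using Suc.prems bij by (auto simp: bij_betw_def inv_into_into f_inv_into_f)
      have "?b (Suc n) x = ?b n ?y" by (simp add: funpow_swap1)
      moreover have "(f ^^ Suc n) z = f ((f ^^ n) z)" for z by simp
      ultimately show ?case using Suc.IH[OF y(1)] y(2) by metis
    qed simp
    then show "(f ^^ n) (?b n x) = x" "?b n x \<in> topspace X" by auto
  qed
  have mem: "?b n x \<in> K \<longleftrightarrow> x \<in> (f ^^ n) ` K" if "x \<in> topspace X" "K \<subseteq> topspace X" for n x K
  proof
    assume "?b n x \<in> K"
    then show "x \<in> (f ^^ n) ` K" using b(1)[OF that(1), of n] by (metis imageI)
  next
    assume "x \<in> (f ^^ n) ` K"
    then obtain z where z: "z \<in> K" "x = (f ^^ n) z" by auto
    then have "?b n x = z"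
      using bijn[of n] b[OF that(1), of n] that(2) by (auto simp: bij_betw_def inj_on_def)
    then show "?b n x \<in> K" using z by simp
  qed
  have Lt: "L j \<subseteq> topspace X" for j using L(2) by (rule compactin_subset_topspace)
  have ls: "x \<in> limsup (\<lambda>n. (f ^^ n) ` K) \<longleftrightarrow> (\<forall>N. \<exists>n\<ge>N. x \<in> (f ^^ n) ` K)" for x K
    by (simp add: limsup_INF_SUP Bex_def)
  show ?thesis
  proof (intro equalityI subsetI)
    fix x assume "x \<in> backward_nonescaping X f"
    then obtain K where x: "x \<in> topspace X" and K: "compactin X K" and io: "\<forall>N. \<exists>n\<ge>N. ?b n x \<in> K"
      unfolding backward_nonescaping_def tends_to_infinity_def by auto
    obtain \<F> where \<F>: "finite \<F>" "\<F> \<subseteq> range V" "K \<subseteq> \<Union>\<F>"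
      using K V unfolding compactin_def by (metis (no_types, lifting) imageE)
    obtain J where J: "finite J" "\<F> = V ` J" using \<F>(1,2) by (meson finite_subset_image)
    have "infinite {n. ?b n x \<in> K}" using io by (simp add: infinite_nat_iff_unbounded_le)
    moreover have "{n. ?b n x \<in> K} \<subseteq> (\<Union>j\<in>J. {n. ?b n x \<in> L j})"
    proof
      fix n assume "n \<in> {n. ?b n x \<in> K}"
      then have "?b n x \<in> \<Union> (V ` J)" using \<F>(3) J(2) by blast
      then obtain j where "j \<in> J" "?b n x \<in> V j" by blast
      then show "n \<in> (\<Union>j\<in>J. {n. ?b n x \<in> L j})" using L(1)[of j] by blast
    qed
    ultimately obtain j where "infinite {n. ?b n x \<in> L j}"
      using J(1) by (meson finite_UN_I finite_subset)
    then have "x \<in> limsup (\<lambda>n. (f ^^ n) ` L j)"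
      unfolding ls using mem[OF x Lt] by (simp add: infinite_nat_iff_unbounded_le)
    then show "x \<in> (\<Union>j. limsup (\<lambda>n. (f ^^ n) ` L j))" by blast
  next
    fix x assume "x \<in> (\<Union>j. limsup (\<lambda>n. (f ^^ n) ` L j))"
    then obtain j where j: "\<forall>N. \<exists>n\<ge>N. x \<in> (f ^^ n) ` L j" using ls by blast
    have x: "x \<in> topspace X"
      using j Lt[of j] bijn by (metis (no_types, lifting) bij_betw_imp_surj_on image_mono subsetD)
    then have "\<forall>N. \<exists>n\<ge>N. ?b n x \<in> L j" using j mem[OF x Lt] by blast
    then show "x \<in> backward_nonescaping X f"
      unfolding backward_nonescaping_def tends_to_infinity_def using x L(2)[of j] by blast
  qed
qed

text \<open>
  The measures of the iterated images of \<open>L\<close> form a convergent geometric series, so the lemma of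
  Borel and Cantelli applies.
\<close>

lemma limsup_contracted_null:
  assumes k: "0 \<le> k" "k < 1" and fin: "emeasure N L < \<infinity>"
    and step: "\<And>E. E \<in> sets N \<Longrightarrow> f ` E \<in> sets N \<and> emeasure N (f ` E) = ennreal k * emeasure N E"
    and L: "L \<in> sets N"
  shows "limsup (\<lambda>n. (f ^^ n) ` L) \<in> null_sets N"
proof -
  have *: "(f ^^ n) ` L \<in> sets N \<and> emeasure N ((f ^^ n) ` L) = ennreal (k ^ n) * emeasure N L" for n
  proof (induction n)
    case (Suc n)
    have "(f ^^ Suc n) ` L = f ` (f ^^ n) ` L" by (simp add: image_comp)
    then show ?case
      using step[of "(f ^^ n) ` L"] Suc k by (simp add: ennreal_mult' mult.assoc)
  qed (use L in simp)
  have "measure N ((f ^^ n) ` L) = k ^ n * measure N L" for n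
    using *[of n] k by (simp add: measure_def enn2real_mult)
  then have "summable (\<lambda>n. measure N ((f ^^ n) ` L))"
    using k by (simp add: summable_mult2 summable_geometric)
  moreover have "emeasure N ((f ^^ n) ` L) < \<infinity>" for n
    using *[of n] fin by (simp add: ennreal_mult_less_top)
  ultimately show ?thesis using * by (intro borel_cantelli_limsup1) auto
qed

theorem corollary1:
  fixes X :: "'m topology"
    and A :: "('m, 'n::{finite,wellorder}) chart set"
    and \<omega> :: "('m, 'n) form"
    and f :: "'m \<Rightarrow> 'm"
    and a :: real
    and d :: nat
  assumes "symplectic_manifold X A \<omega>"
    and "CARD('n) = 2 * d"
    and "diffeomorphism X A X A f"
    and "0 < a" and "a < 1"
    and "\<And>x vs. x \<in> topspace X \<Longrightarrow> vs \<in> tangent_lists A 2 x \<Longrightarrow>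
           pullback A A f \<omega> x vs = a * \<omega> x vs"
  shows "backward_nonescaping X f \<in> null_sets (form_measure X A (wedge_power 2 \<omega> d))"
proof (cases "topspace X = {}")
  case True
  then have "backward_nonescaping X f = {}" by (auto simp: backward_nonescaping_def)
  then show ?thesis by simp
next
  case False
  interpret symplectic_manifold X A \<omega> by fact
  let ?g = "\<lambda>c y. \<bar>local_form A c (wedge_power 2 \<omega> d) coord_frame y\<bar>"
  have f: "smooth_map X A X A f" and bij: "bij_betw f (topspace X) (topspace X)"
    using assms(3) by (auto simp: diffeomorphism_def)
  have dom: "x \<in> topspace X" if "c \<in> A" "x \<in> fst c" for c x
    using chart_domain(2)[OF that(1)] that(2) by blast
  have pid: "pullback A A id \<omega> x vs = 1 * \<omega> x vs" if "x \<in> topspace X" "vs \<in> tangent_lists A 2 x" for x vs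
  proof -
    have "map (differential A A id x) vs = vs"
      using that by (intro map_idI differential_id) (auto simp: tangent_lists_def)
    then show ?thesis by (simp add: pullback_def)
  qed
  note density = wedge_power_density[OF smooth_manifold_axioms two_form assms(2)]
  interpret chart_density X A ?g
  proof
    show "continuous_on (snd c ` fst c) (?g c)" if "c \<in> A" for c
      by (intro continuous_intros continuous_local_form_wedge_power two_form that)
         (simp add: length_coord_frame assms(2))
    show "\<bar>det (matrix (local_derivative c c' id x))\<bar> * ?g c' (snd c' x) = ?g c (snd c x)"
      if "c \<in> A" "c' \<in> A" "x \<in> fst c" "x \<in> fst c'" for c c' x
      using density[OF smooth_map_id pid[OF dom[OF that(1,3)]] that(1,3,2)] that(4)
      by (simp flip: abs_mult)
  qed simp
  let ?N = "form_measure X A (wedge_power 2 \<omega> d)"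
  have "?N = (THE N. chart_compatible N)"
    by (simp add: form_measure_def chart_compatible_def chart_measure_def)
  then have N: "chart_compatible ?N"
    using chart_compatible_The[OF False] by simp
  then have stN: "sets ?N = borel_sets_of X" by (simp add: chart_compatible_def)
  \<comment> \<open>The contraction is strict only for \<open>d > 0\<close>.\<close>
  have "0 < CARD('n)" by simp
  then have "0 < d" using assms(2) by simp
  then have k: "0 < a ^ d" "a ^ d < 1" using assms(4,5) by (auto simp: power_less_one_iff)
  have "\<bar>det (matrix (local_derivative c c' f x))\<bar> * ?g c' (snd c' (f x)) = a ^ d * ?g c (snd c x)"
    if "c \<in> A" "c' \<in> A" "x \<in> fst c" "f x \<in> fst c'" for c c' x
    using density[OF f assms(6)[OF dom[OF that(1,3)]] that(1,3,2,4)] k(1)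
    by (simp add: abs_mult flip: abs_mult[of "det _"])
  note image = emeasure_diffeomorphism_image[OF N assms(3) k(1) this]
  let ?P = "{(V, L). openin X V \<and> V \<subseteq> L \<and> compactin X L \<and> emeasure ?N L < \<infinity>}"
  obtain s :: "nat \<Rightarrow> 'm set \<times> 'm set" where s: "\<And>n. s n \<in> ?P" "(\<Union>n. fst (s n)) = topspace X"
  proof (rule countable_cover_sequence[OF second_countable False, of ?P fst])
    show "\<exists>p\<in>?P. x \<in> fst p" if x: "x \<in> topspace X" for x
    proof -
      obtain V L where "openin X V" "x \<in> V" "V \<subseteq> L" "compactin X L" "emeasure ?N L < \<infinity>"
        using finite_compact_neighbourhood[OF N x] .
      then show ?thesis by (intro bexI[of _ "(V, L)"]) auto
    qed
  qed auto
  define V L where "V n = fst (s n)" and "L n = snd (s n)" for n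
  have VL: "openin X (V n)" "V n \<subseteq> L n" "compactin X (L n)" "emeasure ?N (L n) < \<infinity>" for n
    using s(1)[of n] by (auto simp: V_def L_def)
  have "limsup (\<lambda>n. (f ^^ n) ` L j) \<in> null_sets ?N" for j
  proof (rule limsup_contracted_null)
    have "closedin X (L j)" using Hausdorff VL(3) by (rule compactin_imp_closedin)
    then show "L j \<in> sets ?N" unfolding stN by (rule closedin_borel)
  qed (use k VL image stN in auto)
  then have "(\<Union>j. limsup (\<lambda>n. (f ^^ n) ` L j)) \<in> null_sets ?N" by auto
  moreover have "backward_nonescaping X f = (\<Union>j. limsup (\<lambda>n. (f ^^ n) ` L j))"
    using bij VL s(2) by (intro backward_nonescaping_eq_limsup) (auto simp: V_def)
  ultimately show ?thesis by simp
qed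

end
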